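(* Let $k\ge 3$ and $s\ge 1$ be integers, and let \[ c(k,s)=\begin{cases} 3 & \text{if } s=1,\\ \binom{2s+1}{2} & \text{if } k=3,\\ k\binom{s+1}{2} & \text{if } k\ge 4,\ s\ge 2.\end{cases} \] There exists a function $m(n,k,s)=(c(k,s)+o(1))\binom{n}{k-2}$ (as $n\to\infty$) such that for all sufficiently large $n$ the following holds. If $\mathcal{H} \subset \binom{[n]}{k}$ satisfies $\nu(\mathcal{H})\le s$ and $|\mathcal{H}| = m > m(n,k,s)$, then $|\partial\mathcal{H}| \ge |\partial L_{m}EM(n,k,s,1)|$. In particular, if $|\mathcal{H}| = \binom{x}{k} - \binom{x-s}{k} > m(n,k,s)$ for some real $x$, then $|\partial\mathcal{H}| \ge \binom{x}{k-1}$.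
   Context: $[n]=\{1,\dots,n\}$, $\binom{[n]}{k}$ is the family of $k$-subsets of $[n]$. $\nu(\mathcal{H})$ is the matching number: the maximum number of pairwise disjoint members of $\mathcal{H}$. $\partial\mathcal{H}=\{A\in\binom{[n]}{k-1}: A\subset B\text{ for some }B\in\mathcal{H}\}$. Colex order on $\binom{[n]}{k}$: $A\prec B$ iff $\max\big((A\setminus B)\cup(B\setminus A)\big)\in B$; for $\mathcal{F}\subset\binom{[n]}{k}$ and $m\le|\mathcal{F}|$, $L_m\mathcal{F}$ is the set of the first $m$ members of $\mathcal{F}$ in colex order. $EM(n,k,s,1)=\{A\in\binom{[n]}{k}: A\cap[s]\neq\emptyset\}$ (all of $\binom{[n]}{k}$ if $n\le s$). For real $y$ and integer $b\ge0$, $\binom{y}{b}=y(y-1)\cdots(y-b+1)/b!$. *)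

theory Defs
  imports Complex_Main
begin

definition ksubsets :: "nat \<Rightarrow> nat \<Rightarrow> nat set set" where
  "ksubsets n k = {A. A \<subseteq> {1..n} \<and> card A = k}"

definition matching_number :: "nat set set \<Rightarrow> nat" where
  "matching_number H = Max {card M | M. M \<subseteq> H \<and> pairwise disjnt M}"

definition shadow :: "nat \<Rightarrow> nat set set \<Rightarrow> nat set set" where
  "shadow k H = {A. card A = k - 1 \<and> (\<exists>B\<in>H. A \<subseteq> B)}"

definition colex_less :: "nat set \<Rightarrow> nat set \<Rightarrow> bool" where
  "colex_less A B \<longleftrightarrow> A \<noteq> B \<and> Max ((A - B) \<union> (B - A)) \<in> B"

definition Lcolex :: "nat \<Rightarrow> nat set set \<Rightarrow> nat set set" where
  "Lcolex m F = {A \<in> F. card {B \<in> F. colex_less B A} < m}"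

definition EM1 :: "nat \<Rightarrow> nat \<Rightarrow> nat \<Rightarrow> nat set set" where
  "EM1 n k s = {A \<in> ksubsets n k. A \<inter> {1..s} \<noteq> {}}"

definition cks :: "nat \<Rightarrow> nat \<Rightarrow> real" where
  "cks k s = (if s = 1 then 3
              else if k = 3 then real ((2*s+1) choose 2)
              else real k * real ((s+1) choose 2))"

end

theory Submission
  imports Defs "HOL-Combinatorics.Transposition"
begin

text \<open>
  Shifting neither enlarges the shadow nor the matching number, so \<open>H\<close> may be assumed shifted.

  If every member of \<open>H\<close> meets \<open>{1..s}\<close>, split \<open>H\<close> by the smallest point \<open>u\<close>: for shifted \<open>H\<close> the
  link of \<open>u\<close> contains the shadow of the rest, and \<open>|\<partial>H|\<close> is the size of the link plus that of its
  shadow. Induction on the ground set gives the exact inequality, and likewise a Lovasz-type bound.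

  Otherwise \<open>{s+1..s+k} \<in> H\<close>. For a large constant \<open>K\<close>, members with exactly one point in \<open>{1..K}\<close> have that
  point below \<open>s\<close>, and the members with two points there decompose, by their trace outside \<open>{1..K}\<close>,
  into shifted graphs with matching number at most \<open>s\<close>. Such a graph has at most \<open>s\<close> edges per
  non-isolated vertex, strictly fewer once it has more than \<open>2s+1 choose 2\<close> edges. Hence
  \<open>s |\<partial>H| \<ge> (1 + \<epsilon>) |H|\<close> above the threshold, while initial colex segments satisfy
  \<open>s |\<partial>L| \<le> (1 + o(1)) |L|\<close>. This argument has threshold \<open>2s+1 choose 2\<close>, which never exceeds \<open>c(k, s)\<close>.
\<close>

section \<open>Shifting\<close>

text \<open>The ground set is \<open>{a<..n}\<close>, so that deleting its smallest point needs no relabelling.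
  The paper's \<open>EM(n,k,s,1)\<close> is \<open>Fam 0 s n k\<close>, and \<open>t = n\<close> gives all \<open>k\<close>-sets (for \<open>k \<ge> 1\<close>).\<close>

definition Fam :: "nat \<Rightarrow> nat \<Rightarrow> nat \<Rightarrow> nat \<Rightarrow> nat set set" where
  "Fam a t n k = {A. A \<subseteq> {a<..n} \<and> card A = k \<and> A \<inter> {..t} \<noteq> {}}"

definition swap_set :: "nat \<Rightarrow> nat \<Rightarrow> nat set \<Rightarrow> nat set" where
  "swap_set i j A = transpose i j ` A"

text \<open>The compression replacing \<open>j\<close> by \<open>i\<close>, given by membership
  instead of by moving sets: of two sets exchanged by the transposition, the one containing
  \<open>i\<close> survives if either is in \<open>H\<close>, the other only if both are. Sets fixed
  by the transposition keep their status.\<close>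

definition shift :: "nat \<Rightarrow> nat \<Rightarrow> nat set set \<Rightarrow> nat set set" where
  "shift i j H = {A. if i \<in> A \<and> j \<notin> A then A \<in> H \<or> swap_set i j A \<in> H
                     else A \<in> H \<and> swap_set i j A \<in> H}"

definition shifted :: "nat \<Rightarrow> nat set set \<Rightarrow> bool" where
  "shifted a H \<longleftrightarrow> (\<forall>A\<in>H. \<forall>i j. a < i \<longrightarrow> i < j \<longrightarrow> j \<in> A \<longrightarrow> i \<notin> A \<longrightarrow> insert i (A - {j}) \<in> H)"

definition matching_le :: "nat set set \<Rightarrow> nat \<Rightarrow> bool" where
  "matching_le H s \<longleftrightarrow> (\<forall>M. M \<subseteq> H \<longrightarrow> pairwise disjnt M \<longrightarrow> card M \<le> s)"

lemma mem_swap_set: "x \<in> swap_set i j A \<longleftrightarrow> transpose i j x \<in> A"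
  unfolding swap_set_def
  by (metis image_iff transpose_involutory)

lemma swap_set_swap_set [simp]: "swap_set i j (swap_set i j A) = A"
  by (auto simp: set_eq_iff mem_swap_set)

lemma card_swap_set [simp]: "card (swap_set i j A) = card A"
  unfolding swap_set_def by (intro card_image inj_onI) (metis transpose_involutory)

lemma swap_set_mono: "A \<subseteq> B \<Longrightarrow> swap_set i j A \<subseteq> swap_set i j B"
  by (auto simp: swap_set_def)

lemma swap_set_same: "(i \<in> A \<longleftrightarrow> j \<in> A) \<Longrightarrow> swap_set i j A = A"
  by (auto simp: set_eq_iff mem_swap_set transpose_def)

lemma swap_set_replace: "j \<in> A \<Longrightarrow> i \<notin> A \<Longrightarrow> swap_set i j A = insert i (A - {j})"
  by (auto simp: set_eq_iff mem_swap_set transpose_def)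

lemma swap_set_replace': "i \<in> A \<Longrightarrow> j \<notin> A \<Longrightarrow> swap_set i j A = insert j (A - {i})"
  by (auto simp: set_eq_iff mem_swap_set transpose_def)

lemma inj_swap_set: "inj (swap_set i j)"
  by (metis injI swap_set_swap_set)

lemma in_swap_set_iff [simp]:
  "i \<in> swap_set i j A \<longleftrightarrow> j \<in> A" "j \<in> swap_set i j A \<longleftrightarrow> i \<in> A"
  by (simp_all add: mem_swap_set)

text \<open>The same compression as a map on members; its bijectivity transfers the cardinality and
  lets sums over the shifted family be compared member by member.\<close>

definition shift_map :: "nat \<Rightarrow> nat \<Rightarrow> nat set set \<Rightarrow> nat set \<Rightarrow> nat set" where
  "shift_map i j H A = (if j \<in> A \<and> i \<notin> A \<and> swap_set i j A \<notin> H then swap_set i j A else A)"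

lemma bij_betw_shift_map: "bij_betw (shift_map i j H) H (shift i j H)"
proof (rule bij_betwI')
  fix A B assume "A \<in> H" "B \<in> H"
  then show "shift_map i j H A = shift_map i j H B \<longleftrightarrow> A = B"
    unfolding shift_map_def by (auto split: if_splits dest: injD[OF inj_swap_set])
next
  fix A assume "A \<in> H"
  moreover have "swap_set i j A = A" if "i \<in> A \<longleftrightarrow> j \<in> A"
    using that by (rule swap_set_same)
  ultimately show "shift_map i j H A \<in> shift i j H"
    unfolding shift_map_def shift_def by (cases "i \<in> A"; cases "j \<in> A") simp_all
next
  fix A assume A: "A \<in> shift i j H"
  show "\<exists>B\<in>H. A = shift_map i j H B"
  proof (cases "A \<in> H")
    case True
    then show ?thesis using A unfolding shift_map_def shift_def
      by (intro bexI[of _ A]) (auto split: if_splits)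
  next
    case False
    then have "i \<in> A" "j \<notin> A" "swap_set i j A \<in> H"
      using A by (auto simp: shift_def split: if_splits)
    with False show ?thesis unfolding shift_map_def
      by (intro bexI[of _ "swap_set i j A"]) auto
  qed
qed

lemma card_shift: "card (shift i j H) = card H"
  using bij_betw_shift_map bij_betw_same_card by metis

lemma finite_shift: "finite H \<Longrightarrow> finite (shift i j H)"
  using bij_betw_shift_map bij_betw_finite by metis

text \<open>If \<open>A\<close> and its swap both lie in \<open>H\<close>, then
  \<open>E \<subseteq> A\<close> and its swap are both in the shadow. Otherwise \<open>A\<close>
  contains \<open>i\<close> but not \<open>j\<close>: a subset containing \<open>i\<close> needs
  only one of the two, and a subset avoiding \<open>i\<close> also avoids \<open>j\<close>, so it is
  fixed by the swap.\<close>

lemma shadow_shift: "shadow k (shift i j H) \<subseteq> shift i j (shadow k H)"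
proof
  fix E assume "E \<in> shadow k (shift i j H)"
  then obtain A where A: "A \<in> shift i j H" and E: "E \<subseteq> A" "card E = k - 1"
    by (auto simp: shadow_def)
  have sw: "swap_set i j E \<in> shadow k H" if "swap_set i j A \<in> H"
    using that E swap_set_mono[of E A i j] by (auto simp: shadow_def)
  have id: "E \<in> shadow k H" if "A \<in> H"
    using that E by (auto simp: shadow_def)
  show "E \<in> shift i j (shadow k H)"
  proof (cases "A \<in> H \<and> swap_set i j A \<in> H")
    case True
    then show ?thesis using sw id by (auto simp: shift_def)
  next
    case False
    then have I: "i \<in> A" "j \<notin> A" and or: "A \<in> H \<or> swap_set i j A \<in> H"
      using A by (auto simp: shift_def split: if_splits)
    show ?thesis
    proof (cases "i \<in> E")
      case True
      then show ?thesis using sw id or E I by (auto simp: shift_def)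
    next
      case False
      then have "swap_set i j E = E" using swap_set_same[of i E j] E I by auto
      then show ?thesis using sw id or False by (auto simp: shift_def)
    qed
  qed
qed

text \<open>A matching of the shifted family not contained in \<open>H\<close> has a member that
  contains \<open>i\<close> and came from a swap. All other members avoid \<open>i\<close> by
  disjointness, so their swaps are in \<open>H\<close> too, and swapping everything gives a matching
  in \<open>H\<close> of the same size.\<close>

lemma matching_le_shift:
  assumes "matching_le H s"
  shows "matching_le (shift i j H) s"
  unfolding matching_le_def
proof (intro allI impI)
  fix M assume M: "M \<subseteq> shift i j H" "pairwise disjnt M"
  show "card M \<le> s"
  proof (cases "M \<subseteq> H")
    case True
    then show ?thesis using assms M by (auto simp: matching_le_def)
  next
    case False
    then obtain A where A: "A \<in> M" "A \<notin> H" by auto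
    then have I: "i \<in> A" "j \<notin> A" "swap_set i j A \<in> H"
      using M by (auto simp: shift_def split: if_splits)
    have "swap_set i j B \<in> H" if "B \<in> M" for B
    proof (cases "B = A")
      case False
      then have "i \<notin> B" using M(2) that A I by (auto simp: pairwise_def disjnt_def)
      then show ?thesis using that M(1) by (auto simp: shift_def split: if_splits)
    qed (use I in simp)
    moreover have "pairwise disjnt (swap_set i j ` M)"
    proof (rule pairwiseI)
      fix X Y assume "X \<in> swap_set i j ` M" "Y \<in> swap_set i j ` M" "X \<noteq> Y"
      then obtain B C where BC: "B \<in> M" "C \<in> M" "B \<noteq> C" "X = swap_set i j B" "Y = swap_set i j C"
        by blast
      then have "B \<inter> C = {}" using M(2) by (auto simp: pairwise_def disjnt_def)
      then show "disjnt X Y" unfolding disjnt_iff BC mem_swap_set by blast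
    qed
    ultimately have "card (swap_set i j ` M) \<le> s"
      using assms unfolding matching_le_def by blast
    then show ?thesis
      using card_image[OF inj_on_subset[OF inj_swap_set[of i j], of M]] by simp
  qed
qed

lemma shift_Fam:
  assumes "H \<subseteq> Fam a t n k" "a < i" "i < j"
  shows "shift i j H \<subseteq> Fam a t n k"
proof
  fix A assume A: "A \<in> shift i j H"
  show "A \<in> Fam a t n k"
  proof (cases "A \<in> H")
    case False
    then have I: "i \<in> A" "j \<notin> A" "swap_set i j A \<in> H"
      using A by (auto simp: shift_def split: if_splits)
    then have "swap_set i j A \<in> Fam a t n k" using assms by auto
    moreover have "card (swap_set i j A) = card A" by simp
    moreover have "A = insert i (swap_set i j A - {j})"
      using I by (auto simp: swap_set_replace')
    moreover have "i \<in> {a<..n}" and "A \<inter> {..t} \<noteq> {}"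
      if "insert j (A - {i}) \<subseteq> {a<..n}" "insert j (A - {i}) \<inter> {..t} \<noteq> {}"
      using that assms(2,3) I by auto
    ultimately show ?thesis using I
      unfolding Fam_def swap_set_replace'[OF I(1,2)] by auto
  qed (use assms in auto)
qed

lemma finite_Fam [simp]: "finite (Fam a t n k)"
  by (rule finite_subset[of _ "Pow {..n}"]) (auto simp: Fam_def)

lemma finite_mem_Fam: "A \<in> Fam a t n k \<Longrightarrow> finite A"
  by (auto simp: Fam_def intro: finite_subset)

text \<open>Shift until stable. A shift with \<open>i < j\<close> that changes the family lowers the
  total of all elements of all members, which is the induction measure.\<close>

lemma shifted_exists:
  assumes "H \<subseteq> Fam a t n k"
  shows "\<exists>H'. H' \<subseteq> Fam a t n k \<and> shifted a H' \<and> card H' = card H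
    \<and> card (shadow k H') \<le> card (shadow k H) \<and> (\<forall>s. matching_le H s \<longrightarrow> matching_le H' s)"
  using assms
proof (induction "\<Sum>A\<in>H. \<Sum>A" arbitrary: H rule: less_induct)
  case less
  show ?case
  proof (cases "shifted a H")
    case False
    then obtain A i j where A: "A \<in> H" "a < i" "i < j" "j \<in> A" "i \<notin> A" "insert i (A - {j}) \<notin> H"
      by (auto simp: shifted_def)
    have finH: "finite H" using less.prems finite_Fam finite_subset by blast
    have fin: "finite B" if "B \<in> H" for B using that less.prems finite_mem_Fam by blast
    have lt: "\<Sum>(swap_set i j B) < \<Sum>B" if "B \<in> H" "j \<in> B" "i \<notin> B" for B
    proof -
      have "\<Sum>(swap_set i j B) = i + \<Sum>(B - {j})"
        using that fin by (simp add: swap_set_replace)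
      also have "\<dots> < j + \<Sum>(B - {j})" using A by simp
      also have "\<dots> = \<Sum>B" using that fin by (simp add: sum.remove)
      finally show ?thesis .
    qed
    have "(\<Sum>B\<in>shift i j H. \<Sum>B) = (\<Sum>B\<in>H. \<Sum>(shift_map i j H B))"
      using sum.reindex_bij_betw[OF bij_betw_shift_map[of i j H], of "\<lambda>B. \<Sum>B"] by simp
    also have "\<dots> < (\<Sum>B\<in>H. \<Sum>B)"
    proof (rule sum_strict_mono_ex1[OF finH])
      show "\<forall>B\<in>H. \<Sum>(shift_map i j H B) \<le> \<Sum>B"
        using lt by (auto simp: shift_map_def intro: less_imp_le)
      show "\<exists>B\<in>H. \<Sum>(shift_map i j H B) < \<Sum>B"
        using lt A by (intro bexI[of _ A]) (auto simp: shift_map_def swap_set_replace)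
    qed
    finally obtain H' where H': "H' \<subseteq> Fam a t n k" "shifted a H'" "card H' = card (shift i j H)"
        "card (shadow k H') \<le> card (shadow k (shift i j H))"
        "\<forall>s. matching_le (shift i j H) s \<longrightarrow> matching_le H' s"
      using less.hyps[of "shift i j H"] shift_Fam[OF less.prems, of i j] A by blast
    have "finite (shadow k H)"
      by (rule finite_subset[of _ "\<Union>(Pow ` H)"]) (use finH fin in \<open>auto simp: shadow_def\<close>)
    then have "card (shadow k (shift i j H)) \<le> card (shadow k H)"
      using card_mono[OF finite_shift shadow_shift] card_shift by metis
    with H' show ?thesis by (metis card_shift le_trans matching_le_shift)
  qed (use less.prems in auto)
qed

section \<open>Links and the colexicographic order\<close>

lemma finite_shadow:
  assumes "H \<subseteq> Fam a t n k"
  shows "finite (shadow k' H)"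
  by (rule finite_subset[of _ "\<Union>(Pow ` H)"])
    (use assms finite_mem_Fam finite_subset[OF assms finite_Fam] in \<open>auto simp: shadow_def\<close>)

lemma shadow_insertE:
  assumes "E \<in> shadow k H" "H \<subseteq> Fam a t n k" "k \<ge> 1"
  obtains x where "x \<notin> E" "insert x E \<in> H"
proof -
  obtain B where B: "B \<in> H" "E \<subseteq> B" "card E = k - 1"
    using assms(1) by (auto simp: shadow_def)
  have fin: "finite B" "card B = k" using B assms by (auto simp: Fam_def intro: finite_subset)
  then have "card (B - E) = 1" using B assms(3) by (simp add: card_Diff_subset finite_subset)
  then obtain x where "B - E = {x}" by (auto simp: card_1_singleton_iff)
  then have "x \<notin> E" "insert x E = B" using B by auto
  then show thesis using that B by metis
qed

definition link :: "nat \<Rightarrow> nat set set \<Rightarrow> nat set set" where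
  "link u H = {A. u \<notin> A \<and> insert u A \<in> H}"

definition del :: "nat \<Rightarrow> nat set set \<Rightarrow> nat set set" where
  "del u H = {A \<in> H. u \<notin> A}"

text \<open>Removing \<open>Suc a\<close> may remove the only point in \<open>{..t}\<close>, so the
  covering parameter becomes \<open>n\<close>, which only asks for nonempty sets;
  \<open>k \<ge> 2\<close> supplies this.\<close>

lemma link_Fam:
  assumes "H \<subseteq> Fam a t n k" "k \<ge> 2"
  shows "link (Suc a) H \<subseteq> Fam (Suc a) n n (k - 1)"
proof
  fix A assume "A \<in> link (Suc a) H"
  then have A: "Suc a \<notin> A" "insert (Suc a) A \<in> Fam a t n k" using assms by (auto simp: link_def)
  then have "finite A" using finite_mem_Fam by fastforce
  then have c: "card A = k - 1" using A by (auto simp: Fam_def)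
  have "A \<subseteq> {Suc a<..n}"
  proof
    fix x assume "x \<in> A"
    then have "a < x" "x \<le> n" "x \<noteq> Suc a" using A by (auto simp: Fam_def)
    then show "x \<in> {Suc a<..n}" by simp
  qed
  moreover have "A \<noteq> {}" using c assms(2) by auto
  ultimately show "A \<in> Fam (Suc a) n n (k - 1)" using c unfolding Fam_def by fastforce
qed

lemma del_Fam:
  assumes "H \<subseteq> Fam a t n k"
  shows "del (Suc a) H \<subseteq> Fam (Suc a) t n k"
proof
  fix A assume "A \<in> del (Suc a) H"
  then have "Suc a \<notin> A" "A \<in> Fam a t n k" using assms by (auto simp: del_def)
  moreover from this have "A \<subseteq> {Suc a<..n}"
    by (auto simp: Fam_def subset_iff intro: Suc_lessI)
  ultimately show "A \<in> Fam (Suc a) t n k" by (simp add: Fam_def)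
qed

lemma card_link_del:
  assumes "H \<subseteq> Fam a t n k"
  shows "card (link u H) + card (del u H) = card H"
proof -
  have fin: "finite H" using assms finite_Fam finite_subset by blast
  have "A \<in> insert u ` link u H" if "A \<in> H" "u \<in> A" for A
    using that by (intro image_eqI[of _ _ "A - {u}"]) (auto simp: link_def insert_absorb)
  then have H: "H = insert u ` link u H \<union> del u H"
    by (auto simp: link_def del_def)
  have inj: "inj_on (insert u) (link u H)"
    by (intro inj_onI) (simp add: link_def insert_ident)
  have "finite (insert u ` link u H)" "finite (del u H)"
    using fin H finite_Un[of "insert u ` link u H" "del u H"] by auto
  moreover have "insert u ` link u H \<inter> del u H = {}" by (auto simp: del_def)
  ultimately show ?thesis using H card_Un_disjoint card_image[OF inj] by metis
qed

text \<open>If \<open>E\<close> arises from a member avoiding \<open>Suc a\<close> by deleting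
  \<open>x\<close>, then replacing \<open>x\<close> by the smaller \<open>Suc a\<close> stays in
  \<open>H\<close>.\<close>

lemma shadow_del_shifted:
  assumes "H \<subseteq> Fam a t n k" "k \<ge> 1" "shifted a H"
  shows "shadow k (del (Suc a) H) \<subseteq> link (Suc a) H"
proof
  fix E assume "E \<in> shadow k (del (Suc a) H)"
  then obtain x where x: "x \<notin> E" "insert x E \<in> del (Suc a) H"
    using shadow_insertE[OF _ del_Fam[OF assms(1)] assms(2)] by blast
  then have "x > a" "x \<noteq> Suc a" "insert x E \<in> H" "Suc a \<notin> insert x E"
    using assms(1) by (auto simp: del_def Fam_def)
  then have "insert (Suc a) (insert x E - {x}) \<in> H"
    using assms(3) unfolding shifted_def by (metis Suc_lessI insertI1 lessI)
  then show "E \<in> link (Suc a) H" using x by (auto simp: link_def del_def)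
qed

text \<open>Deleting \<open>Suc a\<close> from members gives the link; deleting another point gives
  shadow sets of the link with \<open>Suc a\<close> adjoined. Only the latter contain
  \<open>Suc a\<close>, so the two parts are disjoint.\<close>

lemma card_shadow_link_ge:
  assumes "H \<subseteq> Fam a t n k" "k \<ge> 2"
  shows "card (link (Suc a) H) + card (shadow (k - 1) (link (Suc a) H)) \<le> card (shadow k H)"
proof -
  let ?u = "Suc a" let ?F = "link ?u H"
  have FF: "?F \<subseteq> Fam ?u n n (k - 1)" using link_Fam[OF assms] .
  have nu: "?u \<notin> A" if "A \<in> shadow (k - 1) ?F" for A
    using that by (auto simp: shadow_def link_def)
  have sub: "?F \<union> insert ?u ` shadow (k - 1) ?F \<subseteq> shadow k H"
  proof (intro Un_least subsetI)
    fix A assume A: "A \<in> ?F"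
    then have "card A = k - 1" using FF by (auto simp: Fam_def)
    then show "A \<in> shadow k H" using A by (auto simp: shadow_def link_def)
  next
    fix A assume "A \<in> insert ?u ` shadow (k - 1) ?F"
    then obtain C where C: "A = insert ?u C" "C \<in> shadow (k - 1) ?F" by auto
    then obtain D where D: "D \<in> ?F" "C \<subseteq> D" "card C = k - 1 - 1" by (auto simp: shadow_def)
    have "finite C" using D FF finite_mem_Fam finite_subset by blast
    then have "card A = k - 1" using C D nu assms(2) by simp
    then show "A \<in> shadow k H" using C D unfolding shadow_def link_def by blast
  qed
  have "inj_on (insert ?u) (shadow (k - 1) ?F)"
    using nu by (intro inj_onI) (metis insert_ident)
  then have "card (insert ?u ` shadow (k - 1) ?F) = card (shadow (k - 1) ?F)" by (rule card_image)
  moreover have "?F \<inter> insert ?u ` shadow (k - 1) ?F = {}" by (auto simp: link_def)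
  moreover have "finite ?F" "finite (shadow (k - 1) ?F)"
    using finite_subset[OF FF] finite_shadow[OF FF] by simp_all
  ultimately have "card (?F \<union> insert ?u ` shadow (k - 1) ?F) = card ?F + card (shadow (k - 1) ?F)"
    by (simp add: card_Un_disjoint)
  then show ?thesis using card_mono[OF finite_shadow[OF assms(1)] sub] by simp
qed

text \<open>Further shadow sets could only come from members avoiding \<open>Suc a\<close>, and by
  \<open>shadow_del_shifted\<close> those are already in the link. With
  \<open>card_shadow_link_ge\<close> this is an equality for shifted families.\<close>

lemma card_shadow_link_le:
  assumes "H \<subseteq> Fam a t n k" "k \<ge> 2" "shifted a H"
  shows "card (shadow k H) \<le> card (link (Suc a) H) + card (shadow (k - 1) (link (Suc a) H))"
proof -
  let ?u = "Suc a" let ?F = "link ?u H"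
  have FF: "?F \<subseteq> Fam ?u n n (k - 1)" using link_Fam[OF assms(1,2)] .
  have "shadow k H \<subseteq> ?F \<union> insert ?u ` shadow (k - 1) ?F"
  proof
    fix E assume E: "E \<in> shadow k H"
    then obtain x where x: "x \<notin> E" "insert x E \<in> H"
      using shadow_insertE[OF _ assms(1)] assms(2) by auto
    show "E \<in> ?F \<union> insert ?u ` shadow (k - 1) ?F"
    proof (cases "?u \<in> E")
      case True
      then have "insert x (E - {?u}) \<in> ?F" using x by (auto simp: link_def insert_commute insert_absorb)
      moreover have "finite E" using x assms(1) finite_mem_Fam by fastforce
      then have "card (E - {?u}) = k - 1 - 1" using E True by (simp add: shadow_def)
      ultimately have "E - {?u} \<in> shadow (k - 1) ?F" by (auto simp: shadow_def)
      then show ?thesis using True by (auto simp: insert_absorb intro!: image_eqI[of _ _ "E - {?u}"])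
    next
      case False
      show ?thesis
      proof (cases "x = ?u")
        case True
        then show ?thesis using x by (auto simp: link_def)
      next
        case nx: False
        then have "E \<in> shadow k (del ?u H)"
          using x False E by (auto simp: shadow_def del_def)
        then show ?thesis using shadow_del_shifted[OF assms(1) _ assms(3)] assms(2) by auto
      qed
    qed
  qed
  moreover have "finite ?F" "finite (shadow (k - 1) ?F)"
    using finite_subset[OF FF] finite_shadow[OF FF] by simp_all
  ultimately have "card (shadow k H) \<le> card (?F \<union> insert ?u ` shadow (k - 1) ?F)"
    by (intro card_mono) auto
  also have "\<dots> \<le> card ?F + card (shadow (k - 1) ?F)"
    using card_Un_le card_image_le \<open>finite (shadow (k - 1) ?F)\<close> by (meson add_left_mono le_trans)
  finally show ?thesis .
qed

text \<open>The common induction step of the Kruskal-Katona type theorems: \<open>F\<close> and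
  \<open>G\<close> are the link and the deletion of the point \<open>Suc a\<close> in a shifted
  replacement for \<open>H\<close>.\<close>

lemma shadow_decomposition:
  assumes "H \<subseteq> Fam a t n k" "k \<ge> 2"
  obtains F G where "F \<subseteq> Fam (Suc a) n n (k - 1)" "G \<subseteq> Fam (Suc a) t n k"
    "card F + card G = card H" "card (shadow k G) \<le> card F"
    "card F + card (shadow (k - 1) F) \<le> card (shadow k H)"
proof -
  obtain H' where H': "H' \<subseteq> Fam a t n k" "shifted a H'" "card H' = card H"
    "card (shadow k H') \<le> card (shadow k H)"
    using shifted_exists[OF assms(1)] by blast
  have "finite (link (Suc a) H')"
    using link_Fam[OF H'(1) assms(2)] finite_Fam finite_subset by blast
  then have "card (shadow k (del (Suc a) H')) \<le> card (link (Suc a) H')"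
    using shadow_del_shifted[OF H'(1) _ H'(2)] assms(2) by (intro card_mono) auto
  then show thesis
    using that[OF link_Fam[OF H'(1) assms(2)] del_Fam[OF H'(1)]] card_link_del[OF H'(1)]
      card_shadow_link_ge[OF H'(1) assms(2)] H'(3,4) by (metis order_trans)
qed

section \<open>The colexicographic order on finite sets\<close>

lemma colex_less_iff:
  assumes "finite A" "finite B"
  shows "colex_less A B \<longleftrightarrow> (\<exists>t. t \<in> B \<and> t \<notin> A \<and> (\<forall>x>t. x \<in> A \<longleftrightarrow> x \<in> B))"
proof
  let ?D = "(A - B) \<union> (B - A)"
  have fin: "finite ?D" using assms by auto
  {
    assume *: "colex_less A B"
    then have "?D \<noteq> {}" by (auto simp: colex_less_def)
    then have "Max ?D \<in> ?D" "\<forall>x>Max ?D. x \<notin> ?D"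
      using Max_in[OF fin] Max_ge[OF fin] leD by auto
    then show "\<exists>t. t \<in> B \<and> t \<notin> A \<and> (\<forall>x>t. x \<in> A \<longleftrightarrow> x \<in> B)"
      using * by (intro exI[of _ "Max ?D"]) (auto simp: colex_less_def)
  next
    assume "\<exists>t. t \<in> B \<and> t \<notin> A \<and> (\<forall>x>t. x \<in> A \<longleftrightarrow> x \<in> B)"
    then obtain t where t: "t \<in> B" "t \<notin> A" "\<forall>x>t. x \<in> A \<longleftrightarrow> x \<in> B" by blast
    then have "Max ?D = t" by (intro Max_eqI fin) (auto, (metis not_le)+)
    then show "colex_less A B" using t by (auto simp: colex_less_def)
  }
qed

lemma colex_trans:
  assumes "colex_less A B" "colex_less B C" "finite A" "finite B" "finite C"
  shows "colex_less A C"
proof -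
  obtain t u where t: "t \<in> B" "t \<notin> A" "\<forall>x>t. x \<in> A \<longleftrightarrow> x \<in> B"
    and u: "u \<in> C" "u \<notin> B" "\<forall>x>u. x \<in> B \<longleftrightarrow> x \<in> C"
    using assms by (auto simp: colex_less_iff)
  have "max t u \<in> C \<and> max t u \<notin> A \<and> (\<forall>x>max t u. x \<in> A \<longleftrightarrow> x \<in> C)"
    using t u by (cases t u rule: linorder_cases) (auto simp: max_def)
  then show ?thesis using assms colex_less_iff by blast
qed

lemma colex_total:
  assumes "finite A" "finite B" "A \<noteq> B"
  shows "colex_less A B \<or> colex_less B A"
proof -
  have "Max ((A - B) \<union> (B - A)) \<in> (A - B) \<union> (B - A)"
    using assms by (intro Max_in) auto
  then show ?thesis using assms by (auto simp: colex_less_def Un_commute)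
qed

lemma colex_irrefl: "\<not> colex_less A A"
  by (simp add: colex_less_def)

text \<open>The least member serves to extend an initial segment by its next set, the greatest to
  bound the size of an initial segment.\<close>

lemma colex_least_greatest:
  assumes "finite X" "X \<noteq> {}" "\<And>A. A \<in> X \<Longrightarrow> finite A"
  shows "(\<exists>B\<in>X. \<forall>C\<in>X. C = B \<or> colex_less B C) \<and> (\<exists>B\<in>X. \<forall>C\<in>X. C = B \<or> colex_less C B)"
  using assms
proof (induction X rule: finite_ne_induct)
  case (insert A X)
  then obtain B D where B: "B \<in> X" "\<forall>C\<in>X. C = B \<or> colex_less B C"
    and D: "D \<in> X" "\<forall>C\<in>X. C = D \<or> colex_less C D" by auto
  have fin: "finite C" if "C \<in> insert A X" for C using that insert.prems by auto
  have 1: "\<exists>B\<in>insert A X. \<forall>C\<in>insert A X. C = B \<or> colex_less B C"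
  proof (cases "colex_less A B")
    case True
    then have "\<forall>C\<in>insert A X. C = A \<or> colex_less A C"
      using B fin colex_trans[OF True] by auto
    then show ?thesis by blast
  next
    case False
    then have "A = B \<or> colex_less B A" using colex_total[of A B] fin B by auto
    then show ?thesis using B by blast
  qed
  have 2: "\<exists>B\<in>insert A X. \<forall>C\<in>insert A X. C = B \<or> colex_less C B"
  proof (cases "colex_less D A")
    case True
    then have "\<forall>C\<in>insert A X. C = A \<or> colex_less C A"
      using D fin colex_trans[OF _ True] by auto
    then show ?thesis by blast
  next
    case False
    then have "A = D \<or> colex_less A D" using colex_total[of A D] fin D by auto
    then show ?thesis using D by blast
  qed
  from 1 2 show ?case by blast
qed auto

text \<open>Closure under predecessors instead of a bound on the rank, so that passing to a link or
  adding the next set requires no counting.\<close>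

definition initseg :: "nat set set \<Rightarrow> nat set set \<Rightarrow> bool" where
  "initseg F L \<longleftrightarrow> L \<subseteq> F \<and> (\<forall>A\<in>L. \<forall>B\<in>F. colex_less B A \<longrightarrow> B \<in> L)"

lemma initseg_shifted:
  assumes "initseg (Fam a t n k) L"
  shows "shifted a L"
  unfolding shifted_def
proof (intro ballI allI impI)
  fix A i j assume A: "A \<in> L" "a < i" "i < j" "j \<in> A" "i \<notin> A"
  then have AF: "A \<in> Fam a t n k" using assms by (auto simp: initseg_def)
  then have fin: "finite A" by (rule finite_mem_Fam)
  have "card (insert i (A - {j})) = card A"
    using A fin by (metis card_swap_set swap_set_replace)
  then have "insert i (A - {j}) \<in> Fam a t n k"
    using A AF by (fastforce simp: Fam_def)
  moreover have "colex_less (insert i (A - {j})) A"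
    using A fin by (subst colex_less_iff) (auto intro!: exI[of _ j])
  ultimately show "insert i (A - {j}) \<in> L" using A assms by (auto simp: initseg_def)
qed

lemma colex_less_insert_iff:
  assumes "finite A" "finite B" "u \<notin> A" "u \<notin> B"
  shows "colex_less (insert u A) (insert u B) \<longleftrightarrow> colex_less A B"
  using assms by (auto simp: colex_less_iff)

section \<open>Kruskal--Katona theorems for covered families\<close>

lemma Fam_Suc_subset: "Fam (Suc a) t n k \<subseteq> Fam a t n k"
  by (auto simp: Fam_def)

text \<open>Adjoining a common point preserves the order, and by \<open>Suc a \<le> t\<close> every
  set with \<open>Suc a\<close> adjoined meets \<open>{..t}\<close>. So predecessors in the link
  come from predecessors in \<open>L\<close>.\<close>

lemma initseg_link:
  assumes "initseg (Fam a t n k) L" "k \<ge> 2" "Suc a \<le> t"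
  shows "initseg (Fam (Suc a) n n (k - 1)) (link (Suc a) L)"
  unfolding initseg_def
proof (intro conjI ballI impI)
  have L: "L \<subseteq> Fam a t n k" using assms by (simp add: initseg_def)
  show sub: "link (Suc a) L \<subseteq> Fam (Suc a) n n (k - 1)" using link_Fam[OF L assms(2)] .
  fix A B assume A: "A \<in> link (Suc a) L" and B: "B \<in> Fam (Suc a) n n (k - 1)" "colex_less B A"
  have u: "Suc a \<notin> A" "Suc a \<notin> B" using A B by (auto simp: link_def Fam_def)
  have fin: "finite A" "finite B" using A B sub finite_mem_Fam by blast+
  have le: "Suc a \<le> n" using B(1) by (auto simp: Fam_def)
  have "insert (Suc a) B \<in> Fam a t n k"
    using B(1) u fin assms(2,3) le by (auto simp: Fam_def)
  moreover have "colex_less (insert (Suc a) B) (insert (Suc a) A)"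
    using B(2) u fin by (simp add: colex_less_insert_iff)
  ultimately show "B \<in> link (Suc a) L"
    using A assms(1) u by (auto simp: link_def initseg_def)
qed

text \<open>Filling the least gap of \<open>A\<close> keeps it below the set \<open>B\<close> that follows
  \<open>insert (Suc a) A\<close>, so passing to the next member of the family covers the whole link.\<close>

lemma link_subset_shadow_insert:
  assumes L: "initseg (Fam a t n k) L" "k \<ge> 2"
    and B: "B \<in> Fam (Suc a) t n k" "B \<notin> L"
    and least: "\<And>C. C \<in> Fam (Suc a) t n k \<Longrightarrow> C \<notin> L \<Longrightarrow> C = B \<or> colex_less B C"
  shows "link (Suc a) L \<subseteq> shadow k (insert B (del (Suc a) L))"
proof
  fix A assume A: "A \<in> link (Suc a) L"
  have LF: "L \<subseteq> Fam a t n k" using L by (simp add: initseg_def)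
  have AF: "A \<in> Fam (Suc a) n n (k - 1)" using link_Fam[OF LF L(2)] A by auto
  let ?A = "insert (Suc a) A"
  have AL: "?A \<in> L" "Suc a \<notin> A" using A by (auto simp: link_def)
  have fin: "finite A" "finite B" using AF B finite_mem_Fam by auto
  have BF: "B \<in> Fam a t n k" using B(1) Fam_Suc_subset by blast
  have Bu: "Suc a \<notin> B" and Bgt: "\<And>x. x \<in> B \<Longrightarrow> Suc a < x" "\<And>x. x \<in> B \<Longrightarrow> x \<le> n"
    using B(1) by (auto simp: Fam_def)
  have "\<not> colex_less B ?A" using L(1) AL BF B(2) by (auto simp: initseg_def)
  moreover have "?A \<noteq> B" using Bu by auto
  ultimately have "colex_less ?A B" using colex_total[of ?A B] fin by auto
  then obtain x where x: "x \<in> B" "x \<notin> ?A" "\<forall>y>x. y \<in> ?A \<longleftrightarrow> y \<in> B"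
    using fin by (auto simp: colex_less_iff)
  then have xu: "Suc a < x" using Bgt by auto
  define j where "j = (LEAST j. Suc a < j \<and> j \<notin> A)"
  have j: "Suc a < j" "j \<notin> A"
    using LeastI[of "\<lambda>j. Suc a < j \<and> j \<notin> A" x] x xu by (auto simp: j_def)
  have jmin: "y \<in> A" if "Suc a < y" "y < j" for y
    using not_less_Least[of y "\<lambda>j. Suc a < j \<and> j \<notin> A"] that by (auto simp: j_def)
  have jx: "j \<le> x" unfolding j_def by (rule Least_le) (use x xu in auto)
  let ?D = "insert j A"
  have cA: "card A = k - 1" using AF by (auto simp: Fam_def)
  have cD: "card ?D = k" using j fin cA L(2) by simp
  obtain z where z: "z \<in> B" "z \<le> t" using B(1) by (auto simp: Fam_def)
  \<comment> \<open>Either \<open>j\<close> is \<open>Suc (Suc a)\<close> or that point lies in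
    \<open>A\<close>; it is at most \<open>t\<close> because \<open>B\<close> has a point
    \<open>z\<close> with \<open>Suc a < z \<le> t\<close>.\<close>
  have "?D \<inter> {..t} \<noteq> {}"
  proof (cases "j = Suc (Suc a)")
    case True
    then show ?thesis using z Bgt[OF z(1)] by auto
  next
    case False
    then have "Suc (Suc a) \<in> A" using jmin[of "Suc (Suc a)"] j by auto
    then show ?thesis using z Bgt[OF z(1)] by (auto intro!: exI[of _ "Suc (Suc a)"])
  qed
  then have DF: "?D \<in> Fam (Suc a) t n k"
    using cD j jx AF Bgt(2)[OF x(1)] by (auto simp: Fam_def)
  have "?D = B \<or> colex_less ?D B"
  proof (cases "j = x")
    case True
    have "y \<in> ?D" if "y \<in> B" for y
      using that True x(3) jmin[of y] Bgt(1)[of y] xu by (cases y x rule: linorder_cases) auto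
    then have "B = ?D"
      using cD B(1) fin by (intro card_subset_eq) (auto simp: Fam_def)
    then show ?thesis by simp
  next
    case False
    then have "\<forall>y>x. y \<in> ?D \<longleftrightarrow> y \<in> B" using x(3) jx xu by auto
    then show ?thesis using x False fin by (subst colex_less_iff) auto
  qed
  then have "?D = B \<or> ?D \<in> L"
    using least[OF DF] colex_trans[of ?D B ?D] fin colex_irrefl by blast
  then have "?D \<in> insert B (del (Suc a) L)" using AL j by (auto simp: del_def)
  then show "A \<in> shadow k (insert B (del (Suc a) L))" using cA by (auto simp: shadow_def)
qed

text \<open>Induction on the ground set. The link of \<open>L\<close> is at most as large as
  \<open>F\<close>: otherwise the deletion of \<open>L\<close> is smaller than \<open>G\<close>, so
  still no larger after adding the next set \<open>B\<close>; by induction its shadow then has at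
  most \<open>card F\<close> sets, yet that shadow contains the link of \<open>L\<close>. Now
  induction applies to the links, and for the shifted \<open>L\<close> the link and its shadow
  account for the whole shadow.\<close>

theorem card_shadow_initseg_le:
  assumes "k \<ge> 1" "H \<subseteq> Fam a t n k" "initseg (Fam a t n k) L" "card L \<le> card H"
  shows "card (shadow k L) \<le> card (shadow k H)"
  using assms
proof (induction "n - a" arbitrary: a t k H L rule: less_induct)
  case less
  have LF: "L \<subseteq> Fam a t n k" using less.prems by (simp add: initseg_def)
  show ?case
  proof (cases "L = {}")
    case True
    then show ?thesis by (simp add: shadow_def)
  next
    case False
    then obtain A where A: "A \<in> Fam a t n k" using LF by auto
    then have an: "a < n" "Suc a \<le> t" by (fastforce simp: Fam_def)+
    have "card L > 0" using False LF finite_subset finite_Fam card_gt_0_iff by metis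
    then have "H \<noteq> {}" using less.prems(4) by auto
    show ?thesis
    proof (cases "k = 1")
      case True
      have "E = {}" if E: "E \<in> shadow k L" for E
      proof -
        obtain B where "B \<in> L" "E \<subseteq> B" "card E = 0" using E True by (auto simp: shadow_def)
        then show ?thesis using LF finite_mem_Fam[of B a t n k] finite_subset[of E B] by auto
      qed
      then have "card (shadow k L) \<le> card {{} :: nat set}"
        by (intro card_mono) auto
      moreover have "{} \<in> shadow k H" using True \<open>H \<noteq> {}\<close> by (auto simp: shadow_def)
      then have "card (shadow k H) > 0"
        using finite_shadow[OF less.prems(2)] by (auto simp: card_gt_0_iff)
      ultimately show ?thesis by simp
    next
      case False
      then have k: "k \<ge> 2" using less.prems by simp
      obtain F G where F: "F \<subseteq> Fam (Suc a) n n (k - 1)" and G: "G \<subseteq> Fam (Suc a) t n k"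
        and FG: "card F + card G = card H" "card (shadow k G) \<le> card F"
          "card F + card (shadow (k - 1) F) \<le> card (shadow k H)"
        using shadow_decomposition[OF less.prems(2) k] by blast
      let ?F = "link (Suc a) L" let ?G = "del (Suc a) L"
      have shL: "shifted a L" using less.prems initseg_shifted by blast
      have finG: "finite ?G" by (rule finite_subset[OF del_Fam[OF LF] finite_Fam])
      have "card ?F \<le> card F"
      proof (rule ccontr)
        assume neg: "\<not> card ?F \<le> card F"
        then have lt: "card ?G < card G"
          using card_link_del[OF LF, of "Suc a"] FG(1) less.prems(4) by linarith
        let ?X = "Fam (Suc a) t n k - ?G"
        have "?X \<noteq> {}"
          using lt G finG card_mono[of ?G G] by auto
        then obtain B where B: "B \<in> ?X" "\<forall>C\<in>?X. C = B \<or> colex_less B C"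
          using colex_least_greatest[of ?X] finite_mem_Fam finite_Fam by blast
        have notL: "C \<notin> L \<longleftrightarrow> C \<notin> ?G" if "C \<in> Fam (Suc a) t n k" for C
          using that by (auto simp: del_def Fam_def)
        have "initseg (Fam (Suc a) t n k) (insert B ?G)"
          unfolding initseg_def
        proof (intro conjI ballI impI)
          show "insert B ?G \<subseteq> Fam (Suc a) t n k" using B(1) del_Fam[OF LF] by auto
          fix A C assume A: "A \<in> insert B ?G" and C: "C \<in> Fam (Suc a) t n k" "colex_less C A"
          show "C \<in> insert B ?G"
          proof (cases "A = B")
            case True
            then have "\<not> colex_less B C"
              using colex_trans[of B C B] C B(1) colex_irrefl finite_mem_Fam by blast
            then show ?thesis using B(2) C by auto
          next
            case False
            then have "A \<in> L" using A by (auto simp: del_def)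
            moreover have "C \<in> Fam a t n k" using C(1) Fam_Suc_subset by blast
            ultimately have "C \<in> L" using C(2) less.prems(3) unfolding initseg_def by blast
            then show ?thesis using notL[OF C(1)] by auto
          qed
        qed
        moreover have "card (insert B ?G) \<le> card G"
          using lt finG by (simp add: card_insert_if)
        ultimately have "card (shadow k (insert B ?G)) \<le> card F"
          using less.hyps[of "Suc a" k G t "insert B ?G"] an G FG(2) less.prems(1) by linarith
        moreover have "?F \<subseteq> shadow k (insert B ?G)"
          using B notL by (intro link_subset_shadow_insert[OF less.prems(3) k]) auto
        moreover have "finite (shadow k (insert B ?G))"
          using B del_Fam[OF LF] by (intro finite_shadow[of _ "Suc a" t n k]) auto
        ultimately show False using neg card_mono by (metis le_trans)
      qed
      moreover have "card (shadow (k - 1) ?F) \<le> card (shadow (k - 1) F)"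
        using less.hyps[of "Suc a" "k - 1" F n ?F] an F k calculation
          initseg_link[OF less.prems(3) k an(2)] by simp
      ultimately show ?thesis
        using card_shadow_link_le[OF LF k shL] FG(3) by linarith
    qed
  qed
qed

section \<open>Real binomial coefficients and Lovasz-type bounds\<close>

lemma gbinomial_mono_real:
  fixes x y :: real
  assumes "real k - 1 \<le> x" "x \<le> y"
  shows "0 \<le> x gchoose k" "x gchoose k \<le> y gchoose k"
proof -
  have "0 \<le> (\<Prod>i = 0..<k. x - real i)" using assms by (intro prod_nonneg) auto
  then show "0 \<le> x gchoose k" by (simp add: gbinomial_prod_rev)
  have "(\<Prod>i = 0..<k. x - real i) \<le> (\<Prod>i = 0..<k. y - real i)"
    using assms by (intro prod_mono) auto
  then show "x gchoose k \<le> y gchoose k"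
    by (simp add: gbinomial_prod_rev divide_right_mono)
qed

lemma gbinomial_pascal:
  fixes x :: real
  assumes "k \<ge> 1"
  shows "x gchoose k = ((x - 1) gchoose (k - 1)) + ((x - 1) gchoose k)"
  using gbinomial_Suc_Suc[of "x - 1" "k - 1"] assms by simp

text \<open>If \<open>F\<close> had fewer than \<open>(x - 1) gchoose (k - 1)\<close> sets, Pascal's
  rule would make \<open>G\<close> larger than \<open>(x - 1) gchoose k\<close>, and induction for
  \<open>G\<close> would contradict \<open>card (shadow k G) \<le> card F\<close>. Induction for
  \<open>F\<close> with \<open>x - 1\<close> then finishes by Pascal's rule.\<close>

theorem lovasz_shadow:
  fixes x :: real
  assumes "k \<ge> 1" "H \<subseteq> Fam a n n k" "real k \<le> x" "x gchoose k \<le> card H"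
  shows "x gchoose (k - 1) \<le> card (shadow k H)"
  using assms
proof (induction "n - a" arbitrary: a k H x rule: less_induct)
  case less
  have "1 = (real k gchoose k)" by (simp add: binomial_gbinomial[symmetric])
  also have "\<dots> \<le> x gchoose k" using less.prems by (intro gbinomial_mono_real) auto
  finally have "H \<noteq> {}" using less.prems by auto
  then obtain A where "A \<in> Fam a n n k" using less.prems by auto
  then have an: "a < n" by (fastforce simp: Fam_def)
  show ?case
  proof (cases "k = 1")
    case True
    have "{} \<in> shadow k H" using True \<open>H \<noteq> {}\<close> by (auto simp: shadow_def)
    then have "card (shadow k H) > 0"
      using finite_shadow[OF less.prems(2)] by (auto simp: card_gt_0_iff)
    then show ?thesis using True by simp
  next
    case False
    then have k: "k \<ge> 2" using less.prems by simp
    obtain F G where F: "F \<subseteq> Fam (Suc a) n n (k - 1)" and G: "G \<subseteq> Fam (Suc a) n n k"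
      and FG: "card F + card G = card H" "card (shadow k G) \<le> card F"
        "card F + card (shadow (k - 1) F) \<le> card (shadow k H)"
      using shadow_decomposition[OF less.prems(2) k] by blast
    have "(x - 1) gchoose (k - 1) \<le> card F"
    proof (rule ccontr)
      assume neg: "\<not> (x - 1) gchoose (k - 1) \<le> card F"
      have G': "(x - 1) gchoose k < card G"
        using neg less.prems(1,4) gbinomial_pascal[of k x] FG(1) by linarith
      have "(x - 1) gchoose (k - 1) \<le> card (shadow k G)"
      proof (cases "real k \<le> x - 1")
        case True
        then show ?thesis using less.hyps[of "Suc a" k G "x - 1"] an G G' less.prems(1) by simp
      next
        \<comment> \<open>The induction hypothesis needs \<open>x - 1 \<ge> k\<close>. Below that,
          one member of \<open>G\<close> already has \<open>k\<close> shadow sets, and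
          \<open>k\<close> bounds the required binomial.\<close>
        case x: False
        have "0 \<le> (x - 1) gchoose k" using less.prems by (intro gbinomial_mono_real) auto
        then have "G \<noteq> {}" using G' by auto
        then obtain A where A: "A \<in> G" by auto
        then have cA: "card A = k" "finite A" using A G finite_mem_Fam[of A "Suc a" n n k] unfolding Fam_def by blast+
        have "(\<lambda>y. A - {y}) ` A \<subseteq> shadow k G" using A cA by (auto simp: shadow_def)
        then have "card ((\<lambda>y. A - {y}) ` A) \<le> card (shadow k G)"
          using finite_shadow[OF G] by (rule card_mono[rotated])
        moreover have "inj_on (\<lambda>y. A - {y}) A" by (auto simp: inj_on_def)
        ultimately have "k \<le> card (shadow k G)" using cA by (simp add: card_image)
        moreover have "(x - 1) gchoose (k - 1) \<le> real k gchoose (k - 1)"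
          using less.prems x k by (intro gbinomial_mono_real) auto
        moreover have "real k gchoose (k - 1) = real k"
          using k binomial_symmetric[of "k - 1" k] by (simp add: binomial_gbinomial[symmetric])
        ultimately show ?thesis by linarith
      qed
      then show False using neg FG(2) by linarith
    qed
    moreover from this have "(x - 1) gchoose (k - 1 - 1) \<le> card (shadow (k - 1) F)"
      using less.hyps[of "Suc a" "k - 1" F "x - 1"] an F k less.prems(3) by auto
    ultimately show ?thesis
      using FG(3) gbinomial_pascal[of "k - 1" x] k by linarith
  qed
qed

text \<open>For integral \<open>x\<close> the hypothesis counts the \<open>k\<close>-subsets of an
  \<open>x\<close>-set that meet \<open>s\<close> given points. The link is unrestricted and handled
  by \<open>lovasz_shadow\<close>; the deletion is covered by one point less, and lowering
  \<open>x\<close> and \<open>s\<close> together keeps \<open>x - s\<close>, so the induction runs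
  on \<open>s\<close>.\<close>

theorem lovasz_shadow_covered:
  fixes x :: real
  assumes "k \<ge> 2" "H \<subseteq> Fam a (a + s) n k" "s \<ge> 1" "real k + real s \<le> x"
    "(x gchoose k) - ((x - real s) gchoose k) \<le> card H"
  shows "x gchoose (k - 1) \<le> card (shadow k H)"
  using assms
proof (induction s arbitrary: a H x)
  case (Suc s)
  have k: "k \<ge> 2" using Suc.prems by simp
  obtain F G where F: "F \<subseteq> Fam (Suc a) n n (k - 1)" and G: "G \<subseteq> Fam (Suc a) (Suc a + s) n k"
    and FG: "card F + card G = card H" "card (shadow k G) \<le> card F"
      "card F + card (shadow (k - 1) F) \<le> card (shadow k H)"
    using shadow_decomposition[OF Suc.prems(2) k] by auto
  have "(x - 1) gchoose (k - 1) \<le> card F"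
  proof (rule ccontr)
    assume neg: "\<not> (x - 1) gchoose (k - 1) \<le> card F"
    have eq: "x - real (Suc s) = x - 1 - real s" by simp
    have G': "((x - 1) gchoose k) - ((x - 1 - real s) gchoose k) < card G"
      using neg Suc.prems(5)[unfolded eq] gbinomial_pascal[of k x] k FG(1) by linarith
    show False
    proof (cases "s = 0")
      case True
      \<comment> \<open>With no covering points left the deletion is empty, while \<open>G'\<close>
        makes its size strictly positive.\<close>
      then have "Fam (Suc a) (Suc a + s) n k = {}" by (auto simp: Fam_def)
      then have "G = {}" using G by blast
      then show False using G' True by simp
    next
      case False
      then have "(x - 1) gchoose (k - 1) \<le> card (shadow k G)"
        using Suc.IH[of G "Suc a" "x - 1"] G G' k Suc.prems(4) by simp
      then show False using neg FG(2) by linarith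
    qed
  qed
  moreover from this have "(x - 1) gchoose (k - 1 - 1) \<le> card (shadow (k - 1) F)"
    using lovasz_shadow[of "k - 1" F "Suc a" n "x - 1"] F k Suc.prems(4) by auto
  ultimately show ?case
    using FG(3) gbinomial_pascal[of "k - 1" x] k by linarith
qed simp

section \<open>Shifted families with bounded matching number\<close>

lemma card_mem_Fam: "A \<in> Fam a t n k \<Longrightarrow> card A = k"
  by (simp add: Fam_def)

text \<open>The points of \<open>A\<close> outside \<open>B\<close> all lie above \<open>K\<close>,
  so they can be exchanged one at a time for smaller missing points of \<open>B\<close>.\<close>

lemma shifted_compress:
  assumes "shifted 0 H" "A \<in> H" "finite A" "B \<subseteq> {0<..K}" "card A = card B" "A \<inter> {..K} \<subseteq> B"
  shows "B \<in> H"
  using assms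
proof (induction "card (A - B)" arbitrary: A rule: less_induct)
  case less
  have finB: "finite B" using less.prems(4) finite_subset by blast
  show ?case
  proof (cases "A \<subseteq> B")
    case True
    then have "A = B" using card_subset_eq[OF finB] less.prems by auto
    then show ?thesis using less.prems by simp
  next
    case False
    then obtain j where j: "j \<in> A" "j \<notin> B" by auto
    have "\<not> B \<subseteq> A" using card_subset_eq[of A B] less.prems j by auto
    then obtain i where i: "i \<in> B" "i \<notin> A" by auto
    have ij: "0 < i" "i \<le> K" "K < j" using i j less.prems by auto
    let ?A = "insert i (A - {j})"
    have "?A \<in> H" using less.prems(1,2) i j ij unfolding shifted_def by auto
    moreover have "card ?A = card B"
      using i j less.prems by (metis card_swap_set swap_set_replace)
    moreover have "?A - B = (A - B) - {j}" using i by auto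
    then have "card (?A - B) < card (A - B)"
      using j less.prems(3) by (metis DiffI card_Diff1_less finite_Diff)
    ultimately show ?thesis
      using less.hyps[of ?A] less.prems i ij by auto
  qed
qed

text \<open>Each \<open>B p\<close> is filled up to \<open>k\<close> points from its own block of
  length \<open>k\<close> above \<open>K0\<close>. The filled sets are members by
  \<open>shifted_compress\<close> and pairwise disjoint, a matching of size
  \<open>s + 1\<close>.\<close>

lemma disjoint_heads_impossible:
  fixes B :: "nat \<Rightarrow> nat set"
  assumes H: "shifted 0 H" "H \<subseteq> Fam 0 n n k" "k \<ge> 1" "matching_le H s"
    and B: "\<And>p. p \<le> s \<Longrightarrow> B p \<subseteq> {0<..K0}" "\<And>p. p \<le> s \<Longrightarrow> card (B p) \<le> k"
      "\<And>p. p \<le> s \<Longrightarrow> \<exists>A\<in>H. A \<inter> {..K0 + (s + 1) * k} \<subseteq> B p"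
      "\<And>p q. p \<le> s \<Longrightarrow> q \<le> s \<Longrightarrow> p \<noteq> q \<Longrightarrow> B p \<inter> B q = {}"
  shows False
proof -
  define D where "D p = B p \<union> {K0 + p * k<..K0 + p * k + (k - card (B p))}" for p
  have cD: "card (D p) = k" if "p \<le> s" for p
  proof -
    have "finite (B p)" using B(1)[OF that] finite_subset by blast
    moreover have "B p \<inter> {K0 + p * k<..K0 + p * k + (k - card (B p))} = {}"
      using B(1)[OF that] by auto
    ultimately show ?thesis using B(2)[OF that] by (simp add: D_def card_Un_disjoint)
  qed
  have DH: "D p \<in> H" if p: "p \<le> s" for p
  proof -
    obtain A where A: "A \<in> H" "A \<inter> {..K0 + (s + 1) * k} \<subseteq> B p" using B(3)[OF p] by blast
    then have "A \<in> Fam 0 n n k" using H(2) by auto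
    then have fc: "finite A" "card A = k" by (rule finite_mem_Fam, rule card_mem_Fam)
    have "p * k + k \<le> (s + 1) * k" using p mult_le_mono1[of "p + 1" "s + 1" k] by simp
    then have "x \<le> K0 + (s + 1) * k" if "x \<le> K0 + p * k + (k - card (B p))" for x
      using that by linarith
    then have "{K0 + p * k<..K0 + p * k + (k - card (B p))} \<subseteq> {0<..K0 + (s + 1) * k}"
      by (intro subsetI) (simp del: mult_Suc add_mult_distrib)
    moreover have "{0<..K0} \<subseteq> {0<..K0 + (s + 1) * k}" by auto
    ultimately have "D p \<subseteq> {0<..K0 + (s + 1) * k}" using B(1)[OF p] unfolding D_def by blast
    then show ?thesis
      using fc A cD[OF p] by (intro shifted_compress[OF H(1) A(1)]) (auto simp: D_def)
  qed
  have lt: "D p \<inter> D q = {}" if "p < q" "q \<le> s" for p q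
  proof -
    have "p * k + k \<le> q * k" using that mult_le_mono1[of "p + 1" q k] by simp
    then have "{K0 + p * k<..K0 + p * k + (k - card (B p))}
        \<inter> {K0 + q * k<..K0 + q * k + (k - card (B q))} = {}" by auto
    moreover have "B p \<inter> B q = {}" using B(4)[of p q] that by auto
    moreover have "B p \<subseteq> {..K0}" "B q \<subseteq> {..K0}" using B(1)[of p] B(1)[of q] that by auto
    ultimately show ?thesis unfolding D_def by fastforce
  qed
  then have dis: "D p \<inter> D q = {}" if "p \<noteq> q" "p \<le> s" "q \<le> s" for p q
    using that by (metis Int_commute linorder_neqE_nat)
  have ne: "D p \<noteq> {}" if "p \<le> s" for p using cD[OF that] H(3) by auto
  have "inj_on D {..s}"
    using dis ne by (intro inj_onI) (metis Int_absorb atMost_iff)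
  then have "card (D ` {..s}) = Suc s" by (simp add: card_image)
  moreover have "pairwise disjnt (D ` {..s})"
    by (rule pairwise_imageI) (use dis in \<open>auto simp: disjnt_def\<close>)
  moreover have "D ` {..s} \<subseteq> H" using DH by auto
  ultimately show False using H(4)[unfolded matching_le_def, rule_format, of "D ` {..s}"] by simp
qed

lemma downclosed_eq_interval:
  fixes V :: "nat set"
  assumes "finite V" "0 \<notin> V" "\<And>i j. j \<in> V \<Longrightarrow> 0 < i \<Longrightarrow> i < j \<Longrightarrow> i \<in> V"
  shows "V = {0<..card V}"
proof (cases "V = {}")
  case False
  have "V = {0<..Max V}"
  proof (intro equalityI subsetI)
    fix x assume "x \<in> V"
    then show "x \<in> {0<..Max V}" using assms(1,2) by (auto simp: Max_ge intro: gr0I)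
  next
    fix x assume "x \<in> {0<..Max V}"
    then show "x \<in> V"
      using assms(3)[of "Max V" x] Max_in[OF assms(1) False] by (cases "x = Max V") auto
  qed
  then show ?thesis by (metis card_greaterThanAtMost diff_zero)
qed simp

text \<open>The excluded edge belongs to the nested matching \<open>{1, 2s+2}, \<dots>, {s+1, s+2}\<close>. The only nonempty
  graph attaining the bound is the complete graph on \<open>2s+1\<close> vertices, which is where the threshold
  \<open>2s+1 choose 2\<close> comes from.\<close>

lemma shifted_graph_edges:
  assumes g: "g \<subseteq> {e. e \<subseteq> {0<..K} \<and> card e = 2}" "shifted 0 g"
    and p: "p \<le> s" "{p + 1, 2 * s + 2 - p} \<notin> g" and s: "s \<ge> 1"
  shows "card g \<le> s * card (\<Union>g)"
    and "card g > (2 * s + 1) choose 2 \<Longrightarrow> card g + 1 \<le> s * card (\<Union>g)"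
proof -
  define V v where "V = \<Union>g" and "v = card V"
  have finV: "finite V" by (rule finite_subset[of _ "{0<..K}"]) (use g in \<open>auto simp: V_def\<close>)
  have sh: "insert i (e - {j}) \<in> g" if "e \<in> g" "0 < i" "i < j" "j \<in> e" "i \<notin> e" for e i j
    using g(2) that by (auto simp: shifted_def)
  have down: "i \<in> V" if "j \<in> V" "0 < i" "i < j" for i j
  proof -
    obtain e where e: "e \<in> g" "j \<in> e" using \<open>j \<in> V\<close> by (auto simp: V_def)
    show ?thesis
    proof (cases "i \<in> e")
      case False
      then show ?thesis using sh[OF e(1) that(2,3) e(2)] unfolding V_def by blast
    qed (use e in \<open>auto simp: V_def\<close>)
  qed
  have "0 \<notin> V" using g(1) by (fastforce simp: V_def)
  then have "V = {0<..card V}" using down by (rule downclosed_eq_interval[OF finV])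
  then have V: "V = {0<..v}" by (simp add: v_def)
  have gV: "g \<subseteq> {e. e \<subseteq> V \<and> card e = 2}" using g by (auto simp: V_def)
  have key: "card g \<le> s * v \<and> (card g > (2 * s + 1) choose 2 \<longrightarrow> card g + 1 \<le> s * v)"
  proof (cases "v \<le> 2 * s + 1")
    case True
    have "card g \<le> card {e. e \<subseteq> V \<and> card e = 2}" using gV finV by (intro card_mono) auto
    then have c: "card g \<le> v choose 2" using n_subsets[OF finV, of 2] by (simp add: v_def)
    have "v * (v - 1) \<le> v * (2 * s)" using True by (intro mult_le_mono2) auto
    then have "v * (v - 1) div 2 \<le> v * (2 * s) div 2" by (rule div_le_mono)
    then have "v choose 2 \<le> s * v" unfolding choose_two by (simp add: mult.left_commute mult.commute)
    moreover have "v choose 2 \<le> (2 * s + 1) choose 2"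
      unfolding choose_two by (intro div_le_mono mult_le_mono) (use True in auto)
    ultimately show ?thesis using c by linarith
  next
    case False
    \<comment> \<open>An edge avoiding \<open>{0<..p}\<close> with a point at least
      \<open>2 * s + 2 - p\<close> could be shifted down to the excluded edge, lower endpoint first.
      So every edge meets \<open>{0<..p}\<close> (\<open>?I\<close>) or lies in
      \<open>{p<..2 * s + 1 - p}\<close> (\<open>?J\<close>).\<close>
    let ?I = "(\<lambda>(i, j). {i, j}) ` (SIGMA i : {0<..p}. V - {i})"
    let ?J = "{e. e \<subseteq> {p<..2 * s + 1 - p} \<and> card e = 2}"
    have "g \<subseteq> ?I \<union> ?J"
    proof
      fix e assume e: "e \<in> g"
      then have "card e = 2" "e \<subseteq> V" using gV by auto
      then obtain i j where ij: "e = {i, j}" "i < j" "i \<in> V" "j \<in> V"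
        by (auto simp: card_2_iff) (metis insert_commute linorder_neqE_nat)
      show "e \<in> ?I \<union> ?J"
      proof (cases "i \<le> p")
        case True
        then have "(i, j) \<in> (SIGMA i : {0<..p}. V - {i})" using ij V by auto
        then show ?thesis using ij(1) by (auto intro!: image_eqI[of _ _ "(i, j)"])
      next
        case ip: False
        have "j \<le> 2 * s + 1 - p"
        proof (rule ccontr)
          assume "\<not> j \<le> 2 * s + 1 - p"
          then have j: "2 * s + 2 - p \<le> j" by simp
          have 1: "{p + 1, j} \<in> g"
          proof (cases "i = p + 1")
            case False
            have "insert (p + 1) (e - {i}) \<in> g"
              by (rule sh[OF e]) (use ij ip False in auto)
            moreover have "e - {i} = {j}" using ij by auto
            ultimately show ?thesis by simp
          qed (use ij e in auto)
          have "{p + 1, 2 * s + 2 - p} \<in> g"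
          proof (cases "j = 2 * s + 2 - p")
            case False
            have "insert (2 * s + 2 - p) ({p + 1, j} - {j}) \<in> g"
              by (rule sh[OF 1]) (use j p False in auto)
            moreover have "{p + 1, j} - {j} = {p + 1}" using j p by auto
            ultimately show ?thesis by (simp add: insert_commute)
          qed (use 1 in auto)
          then show False using p by simp
        qed
        then show ?thesis using ij ip \<open>card e = 2\<close> by auto
      qed
    qed
    moreover have finS: "finite (SIGMA i : {0<..p}. V - {i})" using finV by auto
    ultimately have "card g \<le> card (?I \<union> ?J)" by (intro card_mono) auto
    also have "\<dots> \<le> card ?I + card ?J" by (rule card_Un_le)
    also have "card ?I \<le> card (SIGMA i : {0<..p}. V - {i})" by (rule card_image_le[OF finS])
    also have "\<dots> = (\<Sum>i\<in>{0<..p}. card (V - {i}))" using finV by (intro card_SigmaI) auto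
    also have "\<dots> = (\<Sum>i\<in>{0<..p}. v - 1)"
    proof (rule sum.cong[OF refl])
      fix i assume "i \<in> {0<..p}"
      then have "i \<in> V" using V False p by auto
      then show "card (V - {i}) = v - 1" using finV by (simp add: v_def)
    qed
    also have "\<dots> = p * (v - 1)" by simp
    also have "card ?J = (2 * s + 1 - 2 * p) choose 2"
      using n_subsets[of "{p<..2 * s + 1 - p}" 2] p by (simp add: mult_2)
    finally have c: "card g \<le> p * (v - 1) + ((2 * s + 1 - 2 * p) choose 2)" by simp
    \<comment> \<open>The bound is \<open>p * (v - 1) + q * (2 * q + 1)\<close>. As
      \<open>v \<ge> 2 * q + 2\<close>, it is at most \<open>s * v - s\<close>, which leaves room
      for the extra \<open>1\<close>.\<close>
    obtain q where q: "s = p + q" using p le_Suc_ex by blast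
    have "(2 * s + 1 - 2 * p) choose 2 = q * (2 * q + 1)"
      unfolding choose_two q by (simp add: algebra_simps)
    moreover have "p * (v - 1) + p = p * v" using False by (cases v) auto
    moreover have "q * (2 * q + 2) \<le> q * v" using False q by (intro mult_le_mono2) auto
    ultimately have "card g + 1 \<le> s * v"
      using c s q by (cases "q = 0") (auto simp: algebra_simps choose_two)
    then show ?thesis by simp
  qed
  show "card g \<le> s * card (\<Union>g)" using key by (simp add: V_def v_def)
  show "card g > (2 * s + 1) choose 2 \<Longrightarrow> card g + 1 \<le> s * card (\<Union>g)"
    using key by (simp add: V_def v_def)
qed

section \<open>Counting members by their trace on an initial segment\<close>

locale nontrivial_family =
  fixes n k s :: nat and H :: "nat set set"
  assumes k: "k \<ge> 2" and s: "s \<ge> 1" and H: "H \<subseteq> Fam 0 n n k"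
    and shifted: "shifted 0 H" and matching: "matching_le H s"
    and uncovered: "\<exists>A\<in>H. A \<inter> {..s} = {}"
begin

text \<open>Any \<open>K\<close> works whose initial segment has room for completing \<open>s + 1\<close> disjoint traces
  contained in \<open>{1..2s+2+k}\<close> to disjoint \<open>k\<close>-sets.\<close>

definition K :: nat where "K = 2 * s + 2 + k + (s + 1) * k"

definition graph :: "nat set \<Rightarrow> nat set set" where
  "graph C = {e. e \<subseteq> {0<..K} \<and> card e = 2 \<and> e \<union> C \<in> H}"

definition tails :: "nat \<Rightarrow> nat set set" where
  "tails r = {C. C \<subseteq> {K<..n} \<and> card C = r}"

lemma finite_tails [simp]: "finite (tails r)"
  unfolding tails_def by simp

lemma mem_H:
  assumes "A \<in> H"
  shows "A \<subseteq> {0<..n}" "finite A" "card A = k"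
proof -
  have A: "A \<in> Fam 0 n n k" using assms H by auto
  show "A \<subseteq> {0<..n}" using A by (simp add: Fam_def)
  show "finite A" "card A = k" by (rule finite_mem_Fam[OF A], rule card_mem_Fam[OF A])
qed

text \<open>A member missing \<open>{..K}\<close> would be a witness for \<open>s + 1\<close> empty
  heads at once.\<close>

lemma meets_head:
  assumes "A \<in> H"
  shows "A \<inter> {..K} \<noteq> {}"
proof
  assume "A \<inter> {..K} = {}"
  then show False
    using disjoint_heads_impossible[OF shifted H _ matching, of "\<lambda>_. {}" "2 * s + 2 + k"] k assms
    by (auto simp: K_def)
qed

text \<open>If \<open>i \<ge> s\<close>, shifting \<open>i\<close> down gives members with traces
  \<open>{1}, ..., {s}\<close>, and the member disjoint from \<open>{..s}\<close> compresses to
  \<open>{s<..s + k}\<close>: \<open>s + 1\<close> disjoint heads. Here \<open>uncovered\<close>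
  yields the factor \<open>s - 1\<close> used in the counting.\<close>

lemma single_head:
  assumes A: "A \<in> H" "A \<inter> {..K} = {i}"
  shows "0 < i" "i < s"
proof -
  have "i \<in> A" "i \<le> K" using A by auto
  then show i: "0 < i" using mem_H(1)[OF A(1)] by auto
  show "i < s"
  proof (rule ccontr)
    assume "\<not> i < s"
    then have si: "s \<le> i" by simp
    obtain A0 where A0: "A0 \<in> H" "A0 \<inter> {..s} = {}" using uncovered by blast
    have S: "{s<..s + k} \<in> H"
      by (rule shifted_compress[OF shifted A0(1), where K = "s + k"])
        (use A0 mem_H[OF A0(1)] in \<open>auto simp: disjoint_iff not_le\<close>)
    define B where "B p = (if p < s then {p + 1} else {s<..s + k})" for p
    have "\<exists>A\<in>H. A \<inter> {..K} \<subseteq> B p" if "p \<le> s" for p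
    proof (cases "p < s")
      case True
      show ?thesis
      proof (cases "p + 1 = i")
        case False
        then have lt: "p + 1 < i" using True si by simp
        then have "p + 1 \<in> {..K}" using \<open>i \<le> K\<close> by simp
        then have "p + 1 \<notin> A" using A(2) False by blast
        then have "insert (p + 1) (A - {i}) \<in> H"
          using shifted A(1) \<open>i \<in> A\<close> lt unfolding shifted_def by simp
        moreover have "insert (p + 1) (A - {i}) \<inter> {..K} \<subseteq> B p" using A True by (auto simp: B_def)
        ultimately show ?thesis by blast
      qed (use A True in \<open>auto simp: B_def\<close>)
    qed (use S in \<open>auto simp: B_def\<close>)
    then show False
      using k by (intro disjoint_heads_impossible[OF shifted H _ matching, of B "2 * s + 2 + k"])
        (auto simp: B_def K_def split: if_splits)
  qed
qed

text \<open>The pairs for \<open>p \<le> s\<close> are disjoint, so having all of them as edges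
  would give \<open>s + 1\<close> disjoint heads.\<close>

lemma graph_no_matching:
  assumes C: "C \<inter> {..K} = {}"
  shows "\<exists>p\<le>s. {p + 1, 2 * s + 2 - p} \<notin> graph C"
proof (rule ccontr)
  assume neg: "\<not> ?thesis"
  define B where "B p = {p + 1, 2 * s + 2 - p}" for p
  have "\<exists>A\<in>H. A \<inter> {..K} \<subseteq> B p" if "p \<le> s" for p
  proof -
    have "B p \<union> C \<in> H" using neg that by (auto simp: graph_def B_def)
    moreover have "(B p \<union> C) \<inter> {..K} \<subseteq> B p" using C by auto
    ultimately show ?thesis by blast
  qed
  moreover have "card (B p) \<le> k" for p
    using k card_insert_le_m1[of 2 "{2 * s + 2 - p}" "p + 1"] by (simp add: B_def)
  ultimately show False
    using k by (intro disjoint_heads_impossible[OF shifted H _ matching, of B "2 * s + 2 + k"])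
      (auto simp: B_def K_def)
qed

text \<open>The points of \<open>C\<close> lie above \<open>K\<close>, so shifting an edge within
  the head is shifting a member; thus \<open>graph C\<close> is shifted and
  \<open>shifted_graph_edges\<close> applies.\<close>

lemma graph_edges:
  assumes "C \<inter> {..K} = {}"
  shows "card (graph C) \<le> s * card (\<Union>(graph C))"
    and "card (graph C) > (2 * s + 1) choose 2 \<Longrightarrow> card (graph C) + 1 \<le> s * card (\<Union>(graph C))"
proof -
  have sub: "graph C \<subseteq> {e. e \<subseteq> {0<..K} \<and> card e = 2}" by (auto simp: graph_def)
  have sh: "shifted 0 (graph C)"
    unfolding shifted_def
  proof (intro ballI allI impI)
    fix e i j assume e: "e \<in> graph C" and ij: "0 < i" "i < j" "j \<in> e" "i \<notin> e"
    have eK: "e \<subseteq> {0<..K}" "card e = 2" "e \<union> C \<in> H" using e by (auto simp: graph_def)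
    then have "i \<in> {..K}" "j \<in> {..K}" using ij by auto
    then have "i \<notin> C" "j \<notin> C" using assms by blast+
    then have "insert i ((e \<union> C) - {j}) \<in> H"
      using shifted eK(3) ij unfolding shifted_def by auto
    moreover have "insert i ((e \<union> C) - {j}) = insert i (e - {j}) \<union> C" using \<open>j \<notin> C\<close> by auto
    moreover have "card (insert i (e - {j})) = 2"
      using eK(2) ij by (metis card_swap_set swap_set_replace)
    ultimately show "insert i (e - {j}) \<in> graph C" using eK ij by (auto simp: graph_def)
  qed
  obtain p where "p \<le> s" "{p + 1, 2 * s + 2 - p} \<notin> graph C"
    using graph_no_matching[OF assms] by blast
  from shifted_graph_edges[OF sub sh this s]
  show "card (graph C) \<le> s * card (\<Union>(graph C))"
    and "card (graph C) > (2 * s + 1) choose 2 \<Longrightarrow> card (graph C) + 1 \<le> s * card (\<Union>(graph C))" .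
qed

lemma card_graph_le: "card (graph C) \<le> K ^ 2"
proof -
  have "card (graph C) \<le> card {e. e \<subseteq> {0<..K} \<and> card e = 2}"
    by (intro card_mono) (auto simp: graph_def)
  also have "\<dots> = K choose 2" using n_subsets[of "{0<..K}" 2] by simp
  also have "\<dots> \<le> K ^ 2"
    unfolding choose_two power2_eq_square by (rule order_trans[OF div_le_dividend]) simp
  finally show ?thesis .
qed

text \<open>These sets lie in the shadow, and shifting the unique head point down to
  \<open>1\<close> shows that they include the tail of every member with one head point.\<close>

definition base :: "nat set set" where
  "base = {C \<in> tails (k - 1). insert 1 C \<in> H}"

lemma card_one_head: "card {A \<in> H. card (A \<inter> {..K}) = 1} \<le> (s - 1) * card base"
proof -
  have "{A \<in> H. card (A \<inter> {..K}) = 1} \<subseteq> (\<lambda>(i, C). insert i C) ` ({0<..<s} \<times> base)"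
  proof
    fix A assume "A \<in> {A \<in> H. card (A \<inter> {..K}) = 1}"
    then obtain i where A: "A \<in> H" "A \<inter> {..K} = {i}" by (auto simp: card_1_singleton_iff)
    then have i: "0 < i" "i < s" "i \<in> A" using single_head[OF A] by auto
    have "A - {i} \<subseteq> {K<..n}" using A mem_H(1)[OF A(1)] by fastforce
    then have t: "A - {i} \<in> tails (k - 1)" using i mem_H[OF A(1)] by (auto simp: tails_def)
    have "insert 1 (A - {i}) \<in> H"
    proof (cases "i = 1")
      case False
      have "1 \<le> K" by (simp add: K_def)
      then have "1 \<notin> A" using A(2) False by auto
      then show ?thesis using shifted A(1) i False unfolding shifted_def by auto
    qed (use A i in \<open>auto simp: insert_absorb\<close>)
    then have "(i, A - {i}) \<in> {0<..<s} \<times> base" using t i by (auto simp: base_def)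
    moreover have "A = (\<lambda>(i, C). insert i C) (i, A - {i})" using i by auto
    ultimately show "A \<in> (\<lambda>(i, C). insert i C) ` ({0<..<s} \<times> base)" by (rule rev_image_eqI)
  qed
  moreover have fin: "finite ({0<..<s} \<times> base)" by (simp add: base_def)
  ultimately have "card {A \<in> H. card (A \<inter> {..K}) = 1} \<le> card ((\<lambda>(i, C). insert i C) ` ({0<..<s} \<times> base))"
    by (intro card_mono) auto
  also have "\<dots> \<le> card ({0<..<s} \<times> base)" by (rule card_image_le[OF fin])
  finally show ?thesis by (simp add: card_cartesian_product)
qed

lemma finite_graph: "finite (graph C)"
  by (rule finite_subset[of _ "Pow {..K}"]) (auto simp: graph_def)

lemma finite_Union_graph: "finite (\<Union>(graph C))"
  by (rule finite_subset[of _ "{..K}"]) (auto simp: graph_def)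

lemma card_two_head:
  "card {A \<in> H. card (A \<inter> {..K}) = 2} \<le> (\<Sum>C\<in>tails (k - 2). card (graph C))"
proof -
  let ?S = "SIGMA C : tails (k - 2). graph C"
  have "{A \<in> H. card (A \<inter> {..K}) = 2} \<subseteq> (\<lambda>(C, e). e \<union> C) ` ?S"
  proof
    fix A assume "A \<in> {A \<in> H. card (A \<inter> {..K}) = 2}"
    then have A: "A \<in> H" "card (A \<inter> {..K}) = 2" by auto
    have "card (A - A \<inter> {..K}) = k - 2"
      using A mem_H[OF A(1)] by (subst card_Diff_subset) auto
    moreover have "A - A \<inter> {..K} \<subseteq> {K<..n}" using mem_H(1)[OF A(1)] by auto
    ultimately have t: "A - A \<inter> {..K} \<in> tails (k - 2)" by (simp add: tails_def)
    have eq: "(A \<inter> {..K}) \<union> (A - A \<inter> {..K}) = A" by auto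
    have "A \<inter> {..K} \<in> graph (A - A \<inter> {..K})"
      using A mem_H(1)[OF A(1)] by (auto simp: graph_def eq)
    then have "(A - A \<inter> {..K}, A \<inter> {..K}) \<in> ?S" using t by auto
    moreover have "A = (\<lambda>(C, e). e \<union> C) (A - A \<inter> {..K}, A \<inter> {..K})" using eq by simp
    ultimately show "A \<in> (\<lambda>(C, e). e \<union> C) ` ?S" by (rule rev_image_eqI)
  qed
  moreover have fin: "finite ?S" using finite_graph by auto
  ultimately have "card {A \<in> H. card (A \<inter> {..K}) = 2} \<le> card ((\<lambda>(C, e). e \<union> C) ` ?S)"
    by (intro card_mono) auto
  also have "\<dots> \<le> card ?S" by (rule card_image_le[OF fin])
  also have "\<dots> = (\<Sum>C\<in>tails (k - 2). card (graph C))" using finite_graph by (intro card_SigmaI) auto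
  finally show ?thesis .
qed

text \<open>Three points in a bounded set leave \<open>k - 3\<close> others, so these members form
  an error term of lower order. The others may still lie in the head, which only overcounts.\<close>

lemma card_many_head:
  "card {A \<in> H. card (A \<inter> {..K}) \<ge> 3} \<le> 2 ^ (K + 1) * (n choose (k - 3))"
proof -
  let ?S = "Pow {..K} \<times> {C. C \<subseteq> {0<..n} \<and> card C = k - 3}"
  have "{A \<in> H. card (A \<inter> {..K}) \<ge> 3} \<subseteq> (\<lambda>(e, C). e \<union> C) ` ?S"
  proof
    fix A assume "A \<in> {A \<in> H. card (A \<inter> {..K}) \<ge> 3}"
    then have A: "A \<in> H" "3 \<le> card (A \<inter> {..K})" by auto
    obtain e where e: "e \<subseteq> A \<inter> {..K}" "card e = 3" "finite e"
      using obtain_subset_with_card_n[OF A(2)] by blast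
    have "card (A - e) = k - 3" using e mem_H[OF A(1)] by (subst card_Diff_subset) auto
    then have "(e, A - e) \<in> ?S" using e mem_H(1)[OF A(1)] by auto
    moreover have "A = (\<lambda>(e, C). e \<union> C) (e, A - e)" using e by auto
    ultimately show "A \<in> (\<lambda>(e, C). e \<union> C) ` ?S" by (rule rev_image_eqI)
  qed
  moreover have fin: "finite ?S" by auto
  ultimately have "card {A \<in> H. card (A \<inter> {..K}) \<ge> 3} \<le> card ((\<lambda>(e, C). e \<union> C) ` ?S)"
    by (intro card_mono) auto
  also have "\<dots> \<le> card ?S" by (rule card_image_le[OF fin])
  also have "\<dots> = 2 ^ (K + 1) * (n choose (k - 3))"
    using n_subsets[of "{0<..n}" "k - 3"] by (simp add: card_cartesian_product card_Pow)
  finally show ?thesis .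
qed

lemma card_H_le:
  "card H \<le> (s - 1) * card base + (\<Sum>C\<in>tails (k - 2). card (graph C)) + 2 ^ (K + 1) * (n choose (k - 3))"
proof -
  let ?H = "\<lambda>P. {A \<in> H. P (card (A \<inter> {..K}))}"
  have "card (A \<inter> {..K}) = 1 \<or> card (A \<inter> {..K}) = 2 \<or> card (A \<inter> {..K}) \<ge> 3" if "A \<in> H" for A
  proof -
    have "card (A \<inter> {..K}) \<noteq> 0" using meets_head[OF that] by simp
    then show ?thesis by linarith
  qed
  then have "H = ?H (\<lambda>c. c = 1) \<union> ?H (\<lambda>c. c = 2) \<union> ?H (\<lambda>c. c \<ge> 3)" by auto
  then have "card H \<le> card (?H (\<lambda>c. c = 1)) + card (?H (\<lambda>c. c = 2)) + card (?H (\<lambda>c. c \<ge> 3))"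
    by (metis (no_types, lifting) add_mono_thms_linordered_semiring(3) card_Un_le order_trans)
  then show ?thesis using card_one_head card_two_head card_many_head by linarith
qed

text \<open>Sets of \<open>base\<close> miss the head; a tail with a vertex of its graph adjoined
  has exactly one head point, so tail and vertex can be recovered. Hence no shadow set is counted
  twice.\<close>

lemma card_shadow_ge:
  "card base + (\<Sum>C\<in>tails (k - 2). card (\<Union>(graph C))) \<le> card (shadow k H)"
proof -
  let ?S = "SIGMA C : tails (k - 2). \<Union>(graph C)"
  let ?f = "\<lambda>(C, i). insert i C"
  have gK: "i \<le> K" if "i \<in> \<Union>(graph C)" for i C using that by (auto simp: graph_def)
  have tK: "i \<notin> C" if "C \<in> tails r" "i \<le> K" for i C r using that by (auto simp: tails_def)
  have finS: "finite ?S" using finite_Union_graph by (intro finite_SigmaI) auto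
  have base: "base \<subseteq> shadow k H"
    by (auto simp: base_def shadow_def tails_def)
  have "?f ` ?S \<subseteq> shadow k H"
  proof clarify
    fix C i e assume C: "C \<in> tails (k - 2)" and e: "e \<in> graph C" "i \<in> e"
    then have "i \<le> K" using gK by blast
    then have "i \<notin> C" using tK C by blast
    moreover have "finite C" "card C = k - 2" using C finite_subset by (auto simp: tails_def)
    ultimately have "card (insert i C) = k - 1" using k by simp
    moreover have "e \<union> C \<in> H" "insert i C \<subseteq> e \<union> C" using e by (auto simp: graph_def)
    ultimately show "insert i C \<in> shadow k H" by (auto simp: shadow_def)
  qed
  moreover have "base \<inter> ?f ` ?S = {}"
  proof -
    have "insert i C \<notin> base" if "C \<in> tails (k - 2)" "i \<in> \<Union>(graph C)" for C i
      using tK[of "insert i C" "k - 1" i] gK[OF that(2)] by (auto simp: base_def)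
    then show ?thesis by fast
  qed
  moreover have "inj_on ?f ?S"
  proof (rule inj_onI, clarify)
    fix C i D j X Y
    assume C: "C \<in> tails (k - 2)" "D \<in> tails (k - 2)" and eq: "insert i C = insert j D"
      and X: "i \<in> X" "X \<in> graph C" "j \<in> Y" "Y \<in> graph D"
    have "i \<le> K" "j \<le> K" using X gK by blast+
    moreover from this have "i \<notin> C" "j \<notin> D" "j \<notin> C" "i \<notin> D" using tK C by blast+
    ultimately show "C = D \<and> i = j" using eq by (metis insert_iff insert_ident)
  qed
  then have "card (?f ` ?S) = card ?S" by (rule card_image)
  moreover have "card ?S = (\<Sum>C\<in>tails (k - 2). card (\<Union>(graph C)))"
    using finite_Union_graph by (intro card_SigmaI) auto
  moreover have "finite base" by (simp add: base_def)
  ultimately have "card base + (\<Sum>C\<in>tails (k - 2). card (\<Union>(graph C))) = card (base \<union> ?f ` ?S)"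
    using finS by (simp add: card_Un_disjoint)
  also have "\<dots> \<le> card (shadow k H)"
    using base \<open>?f ` ?S \<subseteq> shadow k H\<close> by (intro card_mono finite_shadow[OF H]) auto
  finally show ?thesis .
qed

text \<open>\<open>b\<close> is the size of \<open>base\<close>, \<open>E\<close> and
  \<open>V\<close> total the edges and non-isolated vertices of the graphs over all tails, and
  \<open>X\<close> counts the tails whose graph exceeds \<open>2s+1 choose 2\<close> edges. Each of
  these saves one in \<open>E + X \<le> s * V\<close> and has at most \<open>K^2\<close>
  edges.\<close>

lemma counting_bounds:
  obtains b E V X :: nat where
    "card H \<le> (s - 1) * b + E + 2 ^ (K + 1) * (n choose (k - 3))"
    "b + V \<le> card (shadow k H)" "E + X \<le> s * V"
    "E \<le> ((2 * s + 1) choose 2) * (n choose (k - 2)) + K\<^sup>2 * X"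
proof -
  let ?T = "tails (k - 2)"
  define x where "x C = (if card (graph C) > (2 * s + 1) choose 2 then 1 else 0 :: nat)" for C
  have head: "C \<inter> {..K} = {}" if "C \<in> ?T" for C using that by (auto simp: tails_def)
  have "(\<Sum>C\<in>?T. card (graph C)) + (\<Sum>C\<in>?T. x C) \<le> s * (\<Sum>C\<in>?T. card (\<Union>(graph C)))"
    unfolding sum.distrib[symmetric] sum_distrib_left
    by (rule sum_mono) (use graph_edges head in \<open>auto simp: x_def\<close>)
  moreover have "(\<Sum>C\<in>?T. card (graph C)) \<le> ((2 * s + 1) choose 2) * (n choose (k - 2)) + K\<^sup>2 * (\<Sum>C\<in>?T. x C)"
  proof -
    have "(\<Sum>C\<in>?T. card (graph C)) \<le> (\<Sum>C\<in>?T. ((2 * s + 1) choose 2) + K\<^sup>2 * x C)"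
      by (rule sum_mono) (use card_graph_le in \<open>auto simp: x_def intro: trans_le_add2\<close>)
    also have "\<dots> = card ?T * ((2 * s + 1) choose 2) + K\<^sup>2 * (\<Sum>C\<in>?T. x C)"
      by (simp add: sum.distrib sum_distrib_left)
    also have "card ?T \<le> card {C. C \<subseteq> {0<..n} \<and> card C = k - 2}"
      by (rule card_mono) (auto simp: tails_def)
    also have "\<dots> = n choose (k - 2)" using n_subsets[of "{0<..n}" "k - 2"] by simp
    finally show ?thesis by (simp add: mult.commute)
  qed
  ultimately show thesis using that card_H_le card_shadow_ge by blast
qed

end

section \<open>Asymptotics\<close>

lemma binomial_Suc_dominates:
  fixes n r M :: nat
  assumes "n \<ge> r + M * Suc r"
  shows "M * (n choose r) \<le> n choose Suc r"
proof -
  have "Suc r * (n choose Suc r) = (n - r) * (n choose r)"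
    using binomial_absorption[of r n] binomial_absorb_comp[of n r] by metis
  moreover have "M * Suc r * (n choose r) \<le> (n - r) * (n choose r)"
    by (rule mult_le_mono1) (use assms in linarith)
  ultimately have "Suc r * (M * (n choose r)) \<le> Suc r * (n choose Suc r)"
    by (simp only: ac_simps)
  then show ?thesis by (simp only: mult_le_cancel1)
qed

text \<open>The surplus \<open>s * sh - h\<close> is at least \<open>b + X - P\<close>. The excess
  of \<open>h\<close> over \<open>Q * N\<close> forces \<open>N\<close>, and with it
  \<open>h\<close>, below constant multiples of \<open>b + X\<close>; the factor
  \<open>\<delta> / (4 * T)\<close> makes \<open>P\<close> at most half of \<open>b + X\<close>. So
  the surplus is a fixed fraction of \<open>h\<close>.\<close>

lemma stability_arith:
  fixes s h sh b E V X P N Q \<delta> T D :: real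
  assumes nonneg: "0 \<le> b" "0 \<le> X" "0 \<le> N" "0 \<le> Q" "0 \<le> D" "1 \<le> s" and \<delta>: "0 < \<delta>"
    and h: "h \<le> (s - 1) * b + E + P" and sh: "b + V \<le> sh" and EV: "E + X \<le> s * V"
    and E: "E \<le> Q * N + D * X" and big: "(Q + \<delta>) * N \<le> h" and T: "T = s + D"
    and P: "P \<le> \<delta> / (4 * T) * N"
  shows "(1 + 1 / (2 * (T + 2 * Q * T / \<delta> + 1))) * h \<le> s * sh"
proof -
  let ?W = "T + 2 * Q * T / \<delta> + 1"
  have T1: "1 \<le> T" using T nonneg by simp
  have W: "0 < ?W" using T1 nonneg \<delta> by (intro add_nonneg_pos add_nonneg_nonneg) auto
  have "(s - 1) * b \<le> T * b" "D * X \<le> T * X"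
    using nonneg T by (auto intro!: mult_right_mono)
  then have Ty: "(s - 1) * b + D * X \<le> T * (b + X)" by (simp add: algebra_simps)
  have "\<delta> / (4 * T) \<le> \<delta> / 2" using T1 \<delta> by (intro divide_left_mono) auto
  then have "\<delta> / (4 * T) * N \<le> \<delta> / 2 * N" using nonneg by (intro mult_right_mono)
  then have "\<delta> / 2 * N \<le> T * (b + X)"
    using P h E big Ty by (simp add: algebra_simps)
  then have N: "N \<le> 2 * T / \<delta> * (b + X)" using \<delta> by (simp add: field_simps)
  have "P \<le> \<delta> / (4 * T) * (2 * T / \<delta> * (b + X))"
    by (rule order_trans[OF P mult_left_mono[OF N]]) (use \<delta> T1 in simp)
  also have "\<dots> = (b + X) / 2" using \<delta> T1 by (simp add: field_simps)
  finally have P2: "P \<le> (b + X) / 2" .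
  have "s * b + s * V \<le> s * sh" using mult_left_mono[OF sh, of s] nonneg by (simp add: algebra_simps)
  then have gain: "h + (b + X) / 2 \<le> s * sh" 
  proof -
    have "(s - 1) * b = s * b - b" by (simp add: left_diff_distrib)
    then show ?thesis using \<open>s * b + s * V \<le> s * sh\<close> EV h P2 by argo
  qed
  have "Q * N \<le> 2 * Q * T / \<delta> * (b + X)"
    using mult_left_mono[OF N, of Q] nonneg by (simp add: mult.assoc mult.left_commute)
  then have "h \<le> T * (b + X) + 2 * Q * T / \<delta> * (b + X) + (b + X)"
    using h E P2 Ty nonneg(1,2) by argo
  then have "h \<le> (b + X) * ?W" by (simp add: algebra_simps)
  then have "h / ?W \<le> b + X" using pos_divide_le_eq[OF W] by blast
  then have "h / ?W / 2 \<le> (b + X) / 2" by (rule divide_right_mono) simp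
  have "(1 + 1 / (2 * ?W)) * h = h + h / ?W / 2" by (simp add: distrib_right)
  also have "\<dots> \<le> h + (b + X) / 2" by (rule add_left_mono) fact
  also note gain
  finally show ?thesis .
qed

text \<open>The gain \<open>\<epsilon>\<close> is uniform in \<open>n\<close> because the head size
  \<open>K\<close> depends only on \<open>k\<close> and \<open>s\<close>. It is what beats the
  lower-order terms for initial colex segments.\<close>

lemma nontrivial_family_shadow:
  fixes \<delta> :: real
  assumes "k \<ge> 3" "s \<ge> 1" "\<delta> > 0"
  shows "\<exists>\<epsilon>>0. \<exists>n0. \<forall>n\<ge>n0. \<forall>H. nontrivial_family n k s H \<longrightarrow>
    (real ((2 * s + 1) choose 2) + \<delta>) * real (n choose (k - 2)) \<le> real (card H) \<longrightarrow>
    (1 + \<epsilon>) * real (card H) \<le> real s * real (card (shadow k H))"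
proof -
  define K where "K = nontrivial_family.K k s"
  define Q where "Q = real ((2 * s + 1) choose 2)"
  define T where "T = real s + real (K\<^sup>2)"
  define \<epsilon> where "\<epsilon> = 1 / (2 * (T + 2 * Q * T / \<delta> + 1))"
  \<comment> \<open>Large enough that the members with three or more head points fit into the
    allowance \<open>P\<close> of \<open>stability_arith\<close>.\<close>
  define M where "M = nat \<lceil>2 ^ (K + 1) / (\<delta> / (4 * T))\<rceil>"
  have T: "T \<ge> 1" using assms(2) by (simp add: T_def add_increasing2)
  have "\<epsilon> > 0" unfolding \<epsilon>_def Q_def
    using T assms(3) by (intro divide_pos_pos mult_pos_pos add_nonneg_pos add_nonneg_nonneg) auto
  moreover have "(1 + \<epsilon>) * real (card H) \<le> real s * real (card (shadow k H))"
    if n: "n \<ge> (k - 3) + M * (k - 2)" and ntf: "nontrivial_family n k s H"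
      and big: "(Q + \<delta>) * real (n choose (k - 2)) \<le> real (card H)" for n H
  proof -
    obtain b E V X :: nat where
      1: "card H \<le> (s - 1) * b + E + 2 ^ (K + 1) * (n choose (k - 3))" and
      2: "b + V \<le> card (shadow k H)" "E + X \<le> s * V"
      "E \<le> ((2 * s + 1) choose 2) * (n choose (k - 2)) + K\<^sup>2 * X"
      using nontrivial_family.counting_bounds[OF ntf] unfolding K_def by metis
    have "Suc (k - 3) = k - 2" using assms by simp
    then have "M * (n choose (k - 3)) \<le> n choose (k - 2)"
      using binomial_Suc_dominates[of "k - 3" M n] n by simp
    then have "real M * real (n choose (k - 3)) \<le> real (n choose (k - 2))"
      by (metis of_nat_mono of_nat_mult)
    moreover have "2 ^ (K + 1) / (\<delta> / (4 * T)) \<le> real M"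
      unfolding M_def by (rule real_nat_ceiling_ge)
    then have "2 ^ (K + 1) / (\<delta> / (4 * T)) * real (n choose (k - 3)) \<le> real M * real (n choose (k - 3))"
      by (rule mult_right_mono) simp
    ultimately have "2 ^ (K + 1) / (\<delta> / (4 * T)) * real (n choose (k - 3)) \<le> real (n choose (k - 2))"
      by linarith
    then have P: "2 ^ (K + 1) * real (n choose (k - 3)) \<le> \<delta> / (4 * T) * real (n choose (k - 2))"
      using assms(3) T by (simp add: field_simps)
    have "real (card H) \<le> real ((s - 1) * b + E + 2 ^ (K + 1) * (n choose (k - 3)))"
      using 1 of_nat_mono by blast
    then have h1: "real (card H) \<le> (real s - 1) * real b + real E + 2 ^ (K + 1) * real (n choose (k - 3))"
      using assms(2) by (simp add: of_nat_diff)
    have "real (b + V) \<le> real (card (shadow k H))" "real (E + X) \<le> real (s * V)"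
      "real E \<le> real (((2 * s + 1) choose 2) * (n choose (k - 2)) + K\<^sup>2 * X)"
      using 2 of_nat_mono by blast+
    then show ?thesis
      unfolding \<epsilon>_def
      by (intro stability_arith[where b = "real b" and X = "real X" and V = "real V" and E = "real E"
          and N = "real (n choose (k - 2))" and D = "real (K\<^sup>2)"
          and P = "2 ^ (K + 1) * real (n choose (k - 3))"])
        (use P h1 big assms in \<open>simp_all add: T_def Q_def\<close>)
  qed
  ultimately show ?thesis unfolding Q_def by blast
qed

lemma gbinomial_ratio:
  fixes \<epsilon> :: real and c r :: nat
  assumes "\<epsilon> > 0"
  shows "\<exists>x0. \<forall>x\<ge>x0. x gchoose r \<le> (1 + \<epsilon>) * ((x - real c) gchoose r)"
proof -
  have factor: "((\<lambda>x. (x - real i) / (x - real c - real i)) \<longlongrightarrow> 1) at_top" for i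
  proof -
    have "filterlim (\<lambda>x. x - (real c + real i)) at_top at_top"
      unfolding filterlim_at_top
    proof
      fix Z :: real
      show "\<forall>\<^sub>F x in at_top. Z \<le> x - (real c + real i)"
        using eventually_ge_at_top[of "Z + real c + real i"] by eventually_elim simp
    qed
    then have "((\<lambda>x. 1 + real c / (x - (real c + real i))) \<longlongrightarrow> 1 + 0) at_top"
      by (intro tendsto_intros tendsto_divide_0[OF tendsto_const] filterlim_at_top_imp_at_infinity)
    moreover have "\<forall>\<^sub>F x in at_top. 1 + real c / (x - (real c + real i))
        = (x - real i) / (x - real c - real i)"
      using eventually_gt_at_top[of "real c + real i"] by eventually_elim (simp add: field_simps)
    ultimately show ?thesis using Lim_transform_eventually by fastforce
  qed
  have "((\<lambda>x. \<Prod>i = 0..<r. (x - real i) / (x - real c - real i)) \<longlongrightarrow> (\<Prod>i = 0..<r. 1)) at_top"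
    by (intro tendsto_prod factor)
  then have "\<forall>\<^sub>F x in at_top. (\<Prod>i = 0..<r. (x - real i) / (x - real c - real i)) < 1 + \<epsilon>"
    using assms by (intro order_tendstoD(2)[where y = 1]) auto
  then have "\<forall>\<^sub>F x in at_top. x gchoose r \<le> (1 + \<epsilon>) * ((x - real c) gchoose r)"
    using eventually_gt_at_top[of "real c + real r"]
  proof eventually_elim
    case (elim x)
    have "0 < (\<Prod>i = 0..<r. x - real c - real i)"
      using elim(2) by (intro prod_pos) auto
    then have "(\<Prod>i = 0..<r. x - real i) \<le> (1 + \<epsilon>) * (\<Prod>i = 0..<r. x - real c - real i)"
      using elim(1) by (simp add: prod_dividef field_simps)
    then show ?case
      by (simp add: gbinomial_prod_rev divide_right_mono)
  qed
  then show ?thesis by (simp add: eventually_at_top_linorder)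
qed

text \<open>Only the sets with exactly one point in \<open>{0<..s}\<close> are counted, which
  suffices asymptotically.\<close>

lemma card_Fam_ge:
  assumes "s \<le> y" "k \<ge> 1"
  shows "s * ((y - s) choose (k - 1)) \<le> card (Fam 0 s y k)"
proof -
  let ?T = "{C. C \<subseteq> {s<..y} \<and> card C = k - 1}"
  have disj: "i \<notin> C" if "i \<in> {0<..s}" "C \<in> ?T" for i C using that by auto
  have "inj_on (\<lambda>(i, C). insert i C) ({0<..s} \<times> ?T)"
  proof (rule inj_onI, clarify)
    fix i C j D assume C: "i \<in> {0<..s}" "j \<in> {0<..s}" "C \<subseteq> {s<..y}" "D \<subseteq> {s<..y}"
      and eq: "insert i C = insert j D"
    have "i \<notin> D" "i \<notin> C" "j \<notin> D" "j \<notin> C" using C by auto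
    then show "i = j \<and> C = D" using eq by (metis insert_iff insert_ident)
  qed
  then have c: "card ((\<lambda>(i, C). insert i C) ` ({0<..s} \<times> ?T)) = s * ((y - s) choose (k - 1))"
    using n_subsets[of "{s<..y}" "k - 1"] by (simp add: card_image card_cartesian_product)
  have "(\<lambda>(i, C). insert i C) ` ({0<..s} \<times> ?T) \<subseteq> Fam 0 s y k"
  proof clarify
    fix i C assume C: "i \<in> {0<..s}" "C \<subseteq> {s<..y}" "card C = k - 1"
    then have "finite C" "i \<notin> C" using finite_subset by auto
    then have "card (insert i C) = k" using C assms by simp
    moreover have "insert i C \<subseteq> {0<..y}" using C assms by auto
    ultimately show "insert i C \<in> Fam 0 s y k" using C by (auto simp: Fam_def)
  qed
  from card_mono[OF finite_Fam this] show ?thesis using c by simp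
qed

section \<open>Initial colex segments and their shadows\<close>

lemma Fam_mono: "y \<le> z \<Longrightarrow> Fam a t y k \<subseteq> Fam a t z k"
  by (auto simp: Fam_def)

lemma initseg_Lcolex: "initseg (Fam a t n k) (Lcolex m (Fam a t n k))"
  unfolding initseg_def
proof (intro conjI ballI impI)
  fix A B assume A: "A \<in> Lcolex m (Fam a t n k)" and B: "B \<in> Fam a t n k" "colex_less B A"
  then have "{C \<in> Fam a t n k. colex_less C B} \<subseteq> {C \<in> Fam a t n k. colex_less C A}"
    using colex_trans finite_mem_Fam unfolding Lcolex_def by blast
  then have "card {C \<in> Fam a t n k. colex_less C B} \<le> card {C \<in> Fam a t n k. colex_less C A}"
    by (intro card_mono) auto
  then show "B \<in> Lcolex m (Fam a t n k)" using A B by (auto simp: Lcolex_def)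
qed (auto simp: Lcolex_def)

lemma card_Lcolex_le: "card (Lcolex m (Fam a t n k)) \<le> m"
proof (cases "Lcolex m (Fam a t n k) = {}")
  case False
  let ?L = "Lcolex m (Fam a t n k)"
  have LF: "?L \<subseteq> Fam a t n k" by (auto simp: Lcolex_def)
  have "\<And>A. A \<in> ?L \<Longrightarrow> finite A" using LF finite_mem_Fam by blast
  then obtain B where B: "B \<in> ?L" "\<forall>C\<in>?L. C = B \<or> colex_less C B"
    using colex_least_greatest[of ?L] False finite_subset[OF LF finite_Fam] by blast
  then have "?L \<subseteq> insert B {C \<in> Fam a t n k. colex_less C B}" using LF by auto
  then have "card ?L \<le> card (insert B {C \<in> Fam a t n k. colex_less C B})"
    by (intro card_mono) auto
  also have "\<dots> \<le> Suc (card {C \<in> Fam a t n k. colex_less C B})" by (rule card_insert_le_m1) auto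
  also have "\<dots> \<le> m" using B(1) by (auto simp: Lcolex_def)
  finally show ?thesis .
qed simp

text \<open>A set with a point above \<open>y\<close> comes after all of \<open>Fam a t y k\<close>,
  so it has at least \<open>m\<close> predecessors.\<close>

lemma Lcolex_subset:
  assumes "y \<le> n" "m \<le> card (Fam a t y k)" "A \<in> Lcolex m (Fam a t n k)"
  shows "A \<subseteq> {0<..y}"
proof (rule ccontr)
  assume neg: "\<not> A \<subseteq> {0<..y}"
  have AF: "A \<in> Fam a t n k" using assms(3) by (auto simp: Lcolex_def)
  then have fin: "finite A" by (rule finite_mem_Fam)
  obtain z where z: "z \<in> A" "\<not> (0 < z \<and> z \<le> y)"
    using neg unfolding subset_iff greaterThanAtMost_iff by blast
  then have z: "z \<in> A" "z > y" using AF by (fastforce simp: Fam_def)+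
  have "colex_less B A" if "B \<in> Fam a t y k" for B
  proof -
    have "Max A \<in> A" "Max A \<ge> z" using z fin by (auto intro: Max_in)
    moreover have "\<And>x. x \<in> B \<Longrightarrow> x \<le> y" using that by (auto simp: Fam_def)
    moreover have "finite B" using that by (rule finite_mem_Fam)
    moreover have "\<And>x. x > Max A \<Longrightarrow> x \<notin> A" using fin Max_ge leD by blast
    ultimately show ?thesis
      using z fin by (subst colex_less_iff) (fastforce intro!: exI[of _ "Max A"])+
  qed
  then have "Fam a t y k \<subseteq> {B \<in> Fam a t n k. colex_less B A}" using Fam_mono[OF assms(1)] by blast
  then have "card (Fam a t y k) \<le> card {B \<in> Fam a t n k. colex_less B A}" by (intro card_mono) auto
  then show False using assms(2,3) by (auto simp: Lcolex_def)
qed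

text \<open>Take the least \<open>y\<close> whose covered family has at least \<open>m\<close> sets.
  The segment lies in \<open>{0<..y}\<close>, so its shadow has at most
  \<open>y choose (k - 1)\<close> sets, whereas \<open>m\<close> exceeds the family on
  \<open>y - 1\<close> points, which has at least \<open>s * ((y - 1 - s) choose (k - 1))\<close>
  sets. The ratio of the two binomials tends to \<open>1\<close>.\<close>

lemma card_shadow_Lcolex_le:
  fixes \<epsilon> :: real
  assumes "\<epsilon> > 0" "k \<ge> 1"
  shows "\<exists>M. \<forall>m\<ge>M. \<forall>n\<ge>M. real s * real (card (shadow k (Lcolex m (Fam 0 s n k)))) \<le> (1 + \<epsilon>) * real m"
proof -
  obtain x0 where x0: "\<And>x. x \<ge> x0 \<Longrightarrow> x gchoose (k - 1) \<le> (1 + \<epsilon>) * ((x - real (s + 1)) gchoose (k - 1))"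
    using gbinomial_ratio[OF assms(1)] by blast
  define y0 where "y0 = nat \<lceil>x0\<rceil> + s + 1"
  have "real s * real (card (shadow k (Lcolex m (Fam 0 s n k)))) \<le> (1 + \<epsilon>) * real m"
    if m: "m \<ge> card (Fam 0 s y0 k) + 1" and n: "n \<ge> y0" for m n
  proof -
    let ?L = "Lcolex m (Fam 0 s n k)"
    \<comment> \<open>The alternative \<open>y = n + 1\<close> keeps the minimum defined when
      \<open>m\<close> exceeds the whole family; the segment lies in \<open>{0<..n}\<close>
      anyway.\<close>
    let ?P = "\<lambda>y. y = n + 1 \<or> m \<le> card (Fam 0 s y k)"
    define y where "y = (LEAST y. ?P y)"
    have y: "?P y" unfolding y_def by (rule LeastI[of ?P "n + 1"]) simp
    have ymin: "\<not> ?P z" if "z < y" for z using not_less_Least that unfolding y_def by blast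
    have yn: "y \<le> n + 1" unfolding y_def by (rule Least_le) simp
    have y0y: "y0 < y"
    proof (rule ccontr)
      assume "\<not> y0 < y"
      then have "card (Fam 0 s y k) \<le> card (Fam 0 s y0 k)" "y \<noteq> n + 1"
        using n card_mono[OF finite_Fam Fam_mono[of y y0 0 s k]] by auto
      then show False using y m by linarith
    qed
    have sub: "A \<subseteq> {0<..y}" if "A \<in> ?L" for A
    proof (cases "y = n + 1")
      case True
      then show ?thesis using that by (auto simp: Lcolex_def Fam_def)
    next
      case False
      then show ?thesis using y yn Lcolex_subset[of y n m 0 s k A] that by auto
    qed
    have "shadow k ?L \<subseteq> {E. E \<subseteq> {0<..y} \<and> card E = k - 1}"
      using sub by (fastforce simp: shadow_def)
    then have "card (shadow k ?L) \<le> card {E. E \<subseteq> {0<..y} \<and> card E = k - 1}"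
      by (intro card_mono) auto
    then have sh: "card (shadow k ?L) \<le> y choose (k - 1)" using n_subsets[of "{0<..y}" "k - 1"] by simp
    have "real y \<ge> x0" using y0y unfolding y0_def by linarith
    from x0[OF this] have "real y gchoose (k - 1) \<le> (1 + \<epsilon>) * (real (y - 1 - s) gchoose (k - 1))"
      using y0y by (simp add: y0_def of_nat_diff algebra_simps)
    then have c: "real (y choose (k - 1)) \<le> (1 + \<epsilon>) * real ((y - 1 - s) choose (k - 1))"
      by (simp add: binomial_gbinomial)
    have "s * ((y - 1 - s) choose (k - 1)) \<le> card (Fam 0 s (y - 1) k)"
      using y0y by (intro card_Fam_ge assms) (simp add: y0_def)
    also have "\<dots> \<le> m" using ymin[of "y - 1"] y0y by auto
    finally have "real (s * ((y - 1 - s) choose (k - 1))) \<le> real m" by (rule of_nat_mono)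
    then have d: "(1 + \<epsilon>) * (real s * real ((y - 1 - s) choose (k - 1))) \<le> (1 + \<epsilon>) * real m"
      using assms(1) by (intro mult_left_mono) auto
    have "real s * real (card (shadow k ?L)) \<le> real s * real (y choose (k - 1))"
      using sh by (intro mult_left_mono) auto
    also have "\<dots> \<le> real s * ((1 + \<epsilon>) * real ((y - 1 - s) choose (k - 1)))"
      using c by (intro mult_left_mono) auto
    finally show ?thesis using d by (simp add: mult.left_commute)
  qed
  then show ?thesis
    by (intro exI[of _ "max y0 (card (Fam 0 s y0 k) + 1)"]) auto
qed

text \<open>Telescoping over \<open>s\<close> applications of Pascal's rule, each contributing at
  least the binomial at \<open>x - (s + 1)\<close>.\<close>

lemma gbinomial_diff_ge:
  fixes x :: real
  assumes "k \<ge> 1" "real k + real s \<le> x"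
  shows "real s * ((x - real (s + 1)) gchoose (k - 1)) \<le> (x gchoose k) - ((x - real s) gchoose k)"
proof -
  have "real j * ((x - real (s + 1)) gchoose (k - 1)) \<le> (x gchoose k) - ((x - real j) gchoose k)"
    if "j \<le> s" for j
    using that
  proof (induction j)
    case (Suc j)
    have eq: "x - real j - 1 = x - real (Suc j)" by simp
    have "(x - real j) gchoose k = ((x - real (Suc j)) gchoose (k - 1)) + ((x - real (Suc j)) gchoose k)"
      using gbinomial_pascal[OF assms(1), of "x - real j"] unfolding eq .
    moreover have "(x - real (s + 1)) gchoose (k - 1) \<le> (x - real (Suc j)) gchoose (k - 1)"
      using assms Suc.prems by (intro gbinomial_mono_real) auto
    moreover have "real (Suc j) * ((x - real (s + 1)) gchoose (k - 1)) =
        real j * ((x - real (s + 1)) gchoose (k - 1)) + ((x - real (s + 1)) gchoose (k - 1))"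
      by (simp add: distrib_right del: of_nat_add)
    moreover have "real j * ((x - real (s + 1)) gchoose (k - 1)) \<le> (x gchoose k) - ((x - real j) gchoose k)"
      using Suc by simp
    ultimately show ?case by linarith
  qed simp
  then show ?thesis by blast
qed

text \<open>The equation for \<open>x\<close> may have solutions \<open>x < 0\<close>. For even \<open>k\<close> these give a nonpositive bound,
  and for odd \<open>k\<close> the reflection \<open>x \<mapsto> k - 1 + s - x\<close> preserves the equation.\<close>

lemma reduce_to_large_x:
  fixes x0 :: real
  assumes "k \<ge> 2"
  shows "\<exists>M. \<forall>m>M. \<forall>D\<ge>0.
    (\<forall>x\<ge>x0. m = (x gchoose k) - ((x - real s) gchoose k) \<longrightarrow> x gchoose (k - 1) \<le> D) \<longrightarrow>
    (\<forall>x. m = (x gchoose k) - ((x - real s) gchoose k) \<longrightarrow> x gchoose (k - 1) \<le> D)"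
proof -
  define f where "f x = (x gchoose k) - ((x - real s) gchoose k)" for x :: real
  have "isCont f x" for x
    unfolding f_def gbinomial_prod_rev by (intro continuous_intros) auto
  \<comment> \<open>Bounding \<open>f\<close> on this compact interval makes every nonnegative
    solution for \<open>m > M\<close> exceed \<open>x0\<close>.\<close>
  then obtain M where M: "\<And>x. 0 \<le> x \<Longrightarrow> x \<le> max 0 x0 \<Longrightarrow> f x \<le> M"
    using isCont_bounded[of 0 "max 0 x0" f] by auto
  have "x gchoose (k - 1) \<le> D"
    if m: "m > M" and D: "D \<ge> 0" and fx: "m = f x"
      and large: "\<And>x. x \<ge> x0 \<Longrightarrow> m = f x \<Longrightarrow> x gchoose (k - 1) \<le> D" for m D x
  proof (cases "x \<ge> 0")
    case True
    then have "x \<ge> x0" using M[of x] m fx by (cases "x \<le> max 0 x0") auto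
    then show ?thesis using large fx by blast
  next
    case neg: False
    have up: "x gchoose (k - 1) = (- 1) ^ (k - 1) * ((real k - 2 - x) gchoose (k - 1))"
      using gbinomial_negated_upper[of x "k - 1"] assms by (simp add: of_nat_diff algebra_simps)
    show ?thesis
    proof (cases "even k")
      case True
      then have "x gchoose (k - 1) = - ((real k - 2 - x) gchoose (k - 1))"
        using up assms by simp
      moreover have "0 \<le> (real k - 2 - x) gchoose (k - 1)"
        by (rule gbinomial_mono_real(1)[OF _ order_refl]) (use neg assms in \<open>auto simp: of_nat_diff\<close>)
      ultimately show ?thesis using D by linarith
    next
      case False
      define y where "y = real k - 1 + real s - x"
      have ys: "y - real s = real k - x - 1" "real k - (x - real s) - 1 = y" by (simp_all add: y_def)
      have "f x = - ((real k - x - 1) gchoose k) + ((real k - (x - real s) - 1) gchoose k)"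
        using gbinomial_negated_upper[of x k] gbinomial_negated_upper[of "x - real s" k] False
        by (simp add: f_def)
      then have "f x = f y" unfolding ys f_def by simp
      moreover have "y \<ge> 0" using neg assms by (simp add: y_def)
      ultimately have "y \<ge> x0" "m = f y" using M[of y] m fx by (cases "y \<le> max 0 x0"; auto)+
      then have "y gchoose (k - 1) \<le> D" using large by blast
      moreover have "(real k - 2 - x) gchoose (k - 1) \<le> y gchoose (k - 1)"
        by (rule gbinomial_mono_real(2)) (use neg assms in \<open>auto simp: of_nat_diff y_def\<close>)
      moreover have "x gchoose (k - 1) = (real k - 2 - x) gchoose (k - 1)"
        using up False by simp
      ultimately show ?thesis by linarith
    qed
  qed
  then show ?thesis unfolding f_def by blast
qed

section \<open>Translation into the original notions\<close>

lemma ksubsets_eq_Fam: "k \<ge> 1 \<Longrightarrow> ksubsets n k = Fam 0 n n k"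
proof -
  assume k: "k \<ge> 1"
  have "A \<inter> {..n} \<noteq> {}" if "A \<subseteq> {0<..n}" "card A = k" for A
    using that k by (cases "A = {}") fastforce+
  moreover have "{1..n} = {0<..n}" by auto
  ultimately show ?thesis by (auto simp: ksubsets_def Fam_def)
qed

lemma EM1_eq_Fam: "EM1 n k s = Fam 0 s n k"
proof -
  have "A \<inter> {1..s} = A \<inter> {..s}" if "A \<subseteq> {0<..n}" for A using that by fastforce
  moreover have "{1..n} = {0<..n}" by auto
  ultimately show ?thesis by (auto simp: EM1_def ksubsets_def Fam_def)
qed

lemma matching_le_of_matching_number:
  assumes "finite H" "matching_number H \<le> s"
  shows "matching_le H s"
  unfolding matching_le_def
proof (intro allI impI)
  fix M assume M: "M \<subseteq> H" "pairwise disjnt M"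
  have "finite (card ` {M. M \<subseteq> H \<and> pairwise disjnt M})" using assms(1) by simp
  moreover have "card M \<in> card ` {M. M \<subseteq> H \<and> pairwise disjnt M}" using M by blast
  ultimately have "card M \<le> Max (card ` {M. M \<subseteq> H \<and> pairwise disjnt M})" by (rule Max_ge)
  then show "card M \<le> s"
    using assms(2)[unfolded matching_number_def setcompr_eq_image] by (rule order_trans)
qed

text \<open>Equality for \<open>s = 1\<close> and for \<open>k = 3\<close>; for
  \<open>k \<ge> 4\<close> it follows from
  \<open>s * (2 * s + 1) \<le> 2 * s * (s + 1)\<close>.\<close>

lemma cks_ge:
  assumes "k \<ge> 3" "s \<ge> 1"
  shows "real ((2 * s + 1) choose 2) \<le> cks k s"
proof -
  have "(2 * s + 1) choose 2 \<le> k * ((s + 1) choose 2)" if "k \<ge> 4"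
  proof -
    have "even ((s + 1) * s)" by simp
    then have "2 * ((s + 1) choose 2) = (s + 1) * s" unfolding choose_two by simp
    moreover have "(2 * s + 1) choose 2 = s * (2 * s + 1)" unfolding choose_two by simp
    moreover have "4 * ((s + 1) choose 2) \<le> k * ((s + 1) choose 2)" using that by simp
    moreover have "s * (2 * s + 1) \<le> 2 * ((s + 1) * s)" by (simp add: algebra_simps)
    ultimately show ?thesis by linarith
  qed
  then have "real ((2 * s + 1) choose 2) \<le> real k * real ((s + 1) choose 2)" if "k \<ge> 4"
    using that by (metis of_nat_mono of_nat_mult)
  moreover have "real ((2 * s + 1) choose 2) = 3" if "s = 1" using that by (simp add: choose_two)
  moreover have "k \<ge> 4" if "k \<noteq> 3" using assms(1) that by simp
  ultimately show ?thesis unfolding cks_def by (simp del: of_nat_mult)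
qed

text \<open>Both conclusions under one name, so that the threshold can be read off from the families
  failing either of them.\<close>

definition extremal :: "nat \<Rightarrow> nat \<Rightarrow> nat \<Rightarrow> nat set set \<Rightarrow> bool" where
  "extremal n k s H \<longleftrightarrow> card (shadow k H) \<ge> card (shadow k (Lcolex (card H) (EM1 n k s))) \<and>
    (\<forall>x::real. real (card H) = (x gchoose k) - ((x - real s) gchoose k) \<longrightarrow>
      real (card (shadow k H)) \<ge> x gchoose (k - 1))"

text \<open>After shifting, covered families obey the exact theorems. An uncovered one gains a
  factor \<open>1 + \<epsilon>\<close> over \<open>card H / s\<close>, and for large
  \<open>n\<close> this dominates both the shadow of the initial segment and the real
  binomial.\<close>

lemma large_families_extremal:
  fixes \<delta> :: real
  assumes ks: "k \<ge> 3" "s \<ge> 1" and \<delta>: "\<delta> > 0"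
  shows "\<exists>N. \<forall>n\<ge>N. \<forall>H. H \<subseteq> ksubsets n k \<longrightarrow> matching_number H \<le> s \<longrightarrow>
    real (card H) > (cks k s + \<delta>) * real (n choose (k - 2)) \<longrightarrow> extremal n k s H"
proof -
  obtain \<epsilon> n0 where \<epsilon>: "\<epsilon> > 0" and ntf: "\<And>n H. n \<ge> n0 \<Longrightarrow> nontrivial_family n k s H \<Longrightarrow>
      (real ((2 * s + 1) choose 2) + \<delta>) * real (n choose (k - 2)) \<le> real (card H) \<Longrightarrow>
      (1 + \<epsilon>) * real (card H) \<le> real s * real (card (shadow k H))"
    using nontrivial_family_shadow[OF ks \<delta>] by blast
  obtain x1 where x1: "\<And>x. x \<ge> x1 \<Longrightarrow> x gchoose (k - 1) \<le> (1 + \<epsilon>) * ((x - real (s + 1)) gchoose (k - 1))"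
    using gbinomial_ratio[OF \<epsilon>] by blast
  \<comment> \<open>\<open>x1\<close> serves the ratio estimate, \<open>k + s\<close> the lemmas
    \<open>lovasz_shadow_covered\<close> and \<open>gbinomial_diff_ge\<close>.\<close>
  define x0 where "x0 = max x1 (real k + real s)"
  obtain M1 where M1: "\<And>m D x. m > M1 \<Longrightarrow> D \<ge> 0 \<Longrightarrow>
      (\<And>x. x \<ge> x0 \<Longrightarrow> m = (x gchoose k) - ((x - real s) gchoose k) \<Longrightarrow> x gchoose (k - 1) \<le> D) \<Longrightarrow>
      m = (x gchoose k) - ((x - real s) gchoose k) \<Longrightarrow> x gchoose (k - 1) \<le> D"
    using reduce_to_large_x[of k x0 s] ks by (metis Suc_1 Suc_leD eval_nat_numeral(3))
  obtain M2 where M2: "\<And>m n. m \<ge> M2 \<Longrightarrow> n \<ge> M2 \<Longrightarrow>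
      real s * real (card (shadow k (Lcolex m (Fam 0 s n k)))) \<le> (1 + \<epsilon>) * real m"
    using card_shadow_Lcolex_le[OF \<epsilon>, of k s] ks by auto
  \<comment> \<open>Together with \<open>N\<close> this makes \<open>n choose (k - 2)\<close> at
    least \<open>M\<close>, which forces \<open>card H\<close> past both \<open>M1\<close> and
    \<open>M2\<close>.\<close>
  define M where "M = max M2 (nat \<lceil>M1\<rceil>)"
  define N where "N = max (max n0 M2) ((k - 3) + M * (k - 2))"
  have "extremal n k s H" if n: "n \<ge> N" and H: "H \<subseteq> ksubsets n k" "matching_number H \<le> s"
    and big: "real (card H) > (cks k s + \<delta>) * real (n choose (k - 2))" for n H
  proof -
    let ?m = "card H" and ?N = "real (n choose (k - 2))"
    have nN: "n \<ge> n0" "n \<ge> M2" "n \<ge> (k - 3) + M * (k - 2)" using n by (auto simp: N_def)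
    have HF: "H \<subseteq> Fam 0 n n k" using H(1) ks by (simp add: ksubsets_eq_Fam)
    have finH: "finite H" using finite_subset[OF HF finite_Fam] .
    have "Suc (k - 3) = k - 2" using ks by simp
    then have "M * (n choose (k - 3)) \<le> n choose (k - 2)"
      using binomial_Suc_dominates[of "k - 3" M n] nN(3) by simp
    moreover have "k - 3 \<le> n" using nN(3) by simp
    then have "n choose (k - 3) \<ge> 1" by (simp add: Suc_leI)
    then have "M * 1 \<le> M * (n choose (k - 3))" by (rule mult_le_mono2)
    ultimately have "M \<le> n choose (k - 2)" by linarith
    then have "real M \<le> ?N" by (rule of_nat_mono)
    moreover have Q: "(real ((2 * s + 1) choose 2) + \<delta>) * ?N \<le> (cks k s + \<delta>) * ?N"
      using cks_ge[OF ks] by (intro mult_right_mono) auto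
    moreover have "1 \<le> (2 * s + 1) choose 2" using ks by (simp add: Suc_leI)
    then have "1 * ?N \<le> (real ((2 * s + 1) choose 2) + \<delta>) * ?N"
      using \<delta> by (intro mult_right_mono) linarith+
    ultimately have "real M < real ?m" using big by linarith
    then have m: "?m \<ge> M2" "real ?m > M1" unfolding M_def by linarith+
    obtain H' where H': "H' \<subseteq> Fam 0 n n k" "shifted 0 H'" "card H' = ?m"
      "card (shadow k H') \<le> card (shadow k H)" "matching_le H' s"
      using shifted_exists[OF HF] matching_le_of_matching_number[OF finH H(2)] by blast
    let ?L = "Lcolex ?m (Fam 0 s n k)"
    have goal: "card (shadow k ?L) \<le> card (shadow k H') \<and>
      (\<forall>x\<ge>x0. real ?m = (x gchoose k) - ((x - real s) gchoose k) \<longrightarrow>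
        x gchoose (k - 1) \<le> real (card (shadow k H')))"
    proof (cases "\<exists>A\<in>H'. A \<inter> {..s} = {}")
      case False
      then have cov: "H' \<subseteq> Fam 0 s n k" using H'(1) unfolding Fam_def by auto
      have "card (shadow k ?L) \<le> card (shadow k H')"
        using ks card_Lcolex_le H'(3) by (intro card_shadow_initseg_le[OF _ cov initseg_Lcolex]) auto
      moreover have "x gchoose (k - 1) \<le> real (card (shadow k H'))"
        if "x \<ge> x0" "real ?m = (x gchoose k) - ((x - real s) gchoose k)" for x
        using that ks cov H'(3) by (intro lovasz_shadow_covered[of k H' 0 s n x]) (auto simp: x0_def)
      ultimately show ?thesis by blast
    next
      case True
      then have "nontrivial_family n k s H'"
        using ks H' by (intro nontrivial_family.intro) auto
      then have gain: "(1 + \<epsilon>) * real ?m \<le> real s * real (card (shadow k H'))"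
        using ntf[OF nN(1)] H'(3) Q big by fastforce
      have spos: "real s > 0" using ks by simp
      have "real s * real (card (shadow k ?L)) \<le> real s * real (card (shadow k H'))"
        using M2[OF m(1) nN(2)] gain by linarith
      then have "card (shadow k ?L) \<le> card (shadow k H')"
        using spos by simp
      moreover have "x gchoose (k - 1) \<le> real (card (shadow k H'))"
        if x: "x \<ge> x0" "real ?m = (x gchoose k) - ((x - real s) gchoose k)" for x
      proof -
        have "real s * (x gchoose (k - 1)) \<le> real s * ((1 + \<epsilon>) * ((x - real (s + 1)) gchoose (k - 1)))"
          using x1[of x] x(1) by (intro mult_left_mono) (auto simp: x0_def)
        also have "\<dots> = (1 + \<epsilon>) * (real s * ((x - real (s + 1)) gchoose (k - 1)))" by simp
        also have "\<dots> \<le> (1 + \<epsilon>) * real ?m"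
          unfolding x(2) using ks \<epsilon> x(1)
          by (intro mult_left_mono gbinomial_diff_ge) (auto simp: x0_def)
        also note gain
        finally show ?thesis using spos by simp
      qed
      ultimately show ?thesis by blast
    qed
    have "x gchoose (k - 1) \<le> real (card (shadow k H'))"
      if "real ?m = (x gchoose k) - ((x - real s) gchoose k)" for x
      using M1[OF m(2), of "real (card (shadow k H'))" x] goal that by simp
    then show ?thesis
      unfolding extremal_def EM1_eq_Fam using goal H'(4) by fastforce
  qed
  then show ?thesis by blast
qed

theorem theorem1p10:
  fixes k s :: nat
  assumes "k \<ge> 3" and "s \<ge> 1"
  shows "\<exists>mf :: nat \<Rightarrow> real.
    ((\<lambda>n. mf n / real (n choose (k - 2))) \<longlongrightarrow> cks k s) at_top \<and>
    (\<exists>N. \<forall>n\<ge>N. \<forall>H. H \<subseteq> ksubsets n k \<longrightarrow> matching_number H \<le> s \<longrightarrow>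
        real (card H) > mf n \<longrightarrow>
          card (shadow k H) \<ge> card (shadow k (Lcolex (card H) (EM1 n k s))) \<and>
          (\<forall>x::real. real (card H) = (x gchoose k) - ((x - real s) gchoose k) \<longrightarrow>
              real (card (shadow k H)) \<ge> x gchoose (k - 1)))"
proof -
  text \<open>The threshold is the size of the largest counterexample, hence valid for every \<open>n\<close>.\<close>
  define bad where "bad n = {H. H \<subseteq> ksubsets n k \<and> matching_number H \<le> s \<and> \<not> extremal n k s H}" for n
  \<comment> \<open>The inserted main term keeps the set nonempty and bounds \<open>mf\<close> from
    below.\<close>
  define sizes where "sizes n = insert (cks k s * real (n choose (k - 2))) ((\<lambda>H. real (card H)) ` bad n)" for n
  define mf where "mf n = Max (sizes n)" for n
  have fin: "finite (sizes n)" for n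
    using assms by (simp add: sizes_def bad_def ksubsets_eq_Fam)
  have "extremal n k s H"
    if "H \<subseteq> ksubsets n k" "matching_number H \<le> s" "real (card H) > mf n" for n H
  proof (rule ccontr)
    assume "\<not> extremal n k s H"
    then have "real (card H) \<in> sizes n" using that by (auto simp: sizes_def bad_def)
    then show False using Max_ge[OF fin, of _ n] that(3) by (fastforce simp: mf_def)
  qed
  moreover have "((\<lambda>n. mf n / real (n choose (k - 2))) \<longlongrightarrow> cks k s) at_top"
  proof (rule tendstoI)
    fix e :: real assume e: "e > 0"
    obtain N where N: "\<And>n H. n \<ge> N \<Longrightarrow> H \<subseteq> ksubsets n k \<Longrightarrow> matching_number H \<le> s \<Longrightarrow>
        real (card H) > (cks k s + e / 2) * real (n choose (k - 2)) \<Longrightarrow> extremal n k s H"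
      using large_families_extremal[OF assms, of "e / 2"] e by auto
    show "\<forall>\<^sub>F n in at_top. dist (mf n / real (n choose (k - 2))) (cks k s) < e"
      using eventually_ge_at_top[of "max N k"]
    proof eventually_elim
      case (elim n)
      let ?N = "real (n choose (k - 2))"
      have "k - 2 \<le> n" using elim by linarith
      then have pos: "?N > 0" by simp
      have "cks k s * ?N \<le> mf n"
        unfolding mf_def by (rule Max_ge[OF fin]) (simp add: sizes_def)
      moreover have "v \<le> (cks k s + e / 2) * ?N" if v: "v \<in> sizes n" for v
      proof (cases "v = cks k s * ?N")
        case True
        then show ?thesis using e pos by (simp add: distrib_right)
      next
        case False
        then obtain H where "H \<in> bad n" "v = real (card H)" using v by (auto simp: sizes_def)
        then show ?thesis using N[of n H] elim by (fastforce simp: bad_def not_le)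
      qed
      then have "mf n \<le> (cks k s + e / 2) * ?N"
        unfolding mf_def using fin by (subst Max_le_iff) (auto simp: sizes_def)
      ultimately have "cks k s \<le> mf n / ?N" "mf n / ?N \<le> cks k s + e / 2"
        using pos by (simp_all add: pos_le_divide_eq pos_divide_le_eq)
      then show ?case using e by (simp add: dist_real_def)
    qed
  qed
  ultimately show ?thesis unfolding extremal_def by blast
qed

end
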